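(* Let $s\ge 1$ and let $\Lambda_s$ be the poset consisting of an $s$-element antichain $\{1,2,\dots,s\}$ together with an element $s+1$ greater than all of them. For all integers $0\le i\le j$, the interval $[1^i,(s+1)^j]$ in $(\Lambda_s)^*$ is homotopic to a wedge of $|\langle x^{j-i}\rangle T^s_{i+j}(x)|$ spheres, all of dimension $2j-i-2$.
   Context: $(\Lambda_s)^*$ is the set of finite words over $\Lambda_s$ with generalized subword order: $u\le w$ iff there are indices $i_1<\dots<i_k$, $k=|u|$, with $u(t)\le w(i_t)$ in $\Lambda_s$ for all $t$. $a^m$ denotes the word of $m$ copies of $a$. The generalized Chebyshev polynomials are $T^s_n(x)=\sum_{k=0}^{\lfloor n/2\rfloor}(-1)^k s^{n-2k-1}\left(\binom{n-k}{k}s-\binom{n-k-1}{k}\right)x^{n-2k}$ for $n\ge 0$, and $\langle x^m\rangle T^s_n(x)$ denotes the coefficient of $x^m$. An interval $[u,w]$ is homotopic to a space if the order complex of the open interval $(u,w)$ is. *)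

theory Defs
  imports "HOL-Analysis.Analysis" "HOL-Computational_Algebra.Polynomial"
begin

section \<open>The poset \<open>\<Lambda>\<^sub>s\<close> and generalized subword order\<close>

definition Lambda :: "nat \<Rightarrow> nat set" where
  "Lambda s = {1..s + 1}"

definition Lambda_le :: "nat \<Rightarrow> nat \<Rightarrow> nat \<Rightarrow> bool" where
  "Lambda_le s a b \<longleftrightarrow> a \<in> Lambda s \<and> b \<in> Lambda s \<and> (a = b \<or> b = s + 1)"

text \<open>Words are lists; positions are counted from 0, and \<open>f\<close> lists the indices of the embedding.\<close>

definition subword_le :: "('a \<Rightarrow> 'a \<Rightarrow> bool) \<Rightarrow> 'a list \<Rightarrow> 'a list \<Rightarrow> bool" where
  "subword_le le u w \<longleftrightarrow>
     (\<exists>f. strict_mono_on {..<length u} f \<and>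
          (\<forall>t<length u. f t < length w \<and> le (u ! t) (w ! f t)))"

definition open_interval :: "'a set \<Rightarrow> ('a \<Rightarrow> 'a \<Rightarrow> bool) \<Rightarrow> 'a \<Rightarrow> 'a \<Rightarrow> 'a set" where
  "open_interval P le u w = {x \<in> P. le u x \<and> u \<noteq> x \<and> le x w \<and> x \<noteq> w}"


section \<open>Order complexes\<close>

text \<open>The empty face is included, as is usual for abstract simplicial complexes.\<close>

definition order_complex :: "'a set \<Rightarrow> ('a \<Rightarrow> 'a \<Rightarrow> bool) \<Rightarrow> 'a set set" where
  "order_complex P le = {C. finite C \<and> C \<subseteq> P \<and> Complete_Partial_Order.chain le C}"

text \<open>A point of the realization is given by its barycentric coordinates, extended by 0 to all
  of the vertex type. The topology is that of pointwise convergence, which for a complex with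
  finitely many vertices (the only case used) is the standard one.\<close>

definition geometric_realization :: "'a set set \<Rightarrow> ('a \<Rightarrow> real) topology" where
  "geometric_realization K =
     subtopology (powertop_real UNIV)
       {x. (\<forall>v. 0 \<le> x v) \<and> {v. x v \<noteq> 0} \<in> K \<and> (\<Sum>v | x v \<noteq> 0. x v) = 1}"


section \<open>Wedges of spheres\<close>

text \<open>The wedge of the pointed spaces \<open>(X i, p i)\<close>: \<open>None\<close> is the common base point, so that the
  wedge of the empty family is a point, and \<open>Some (i, x)\<close> is the point \<open>x \<noteq> p i\<close> of the \<open>i\<close>-th
  summand. The topology is the quotient topology of the disjoint union;
  see \<open>quotient_map_wedge_inj\<close> below.\<close>

definition wedge_inj :: "('i \<Rightarrow> 'a) \<Rightarrow> 'i \<times> 'a \<Rightarrow> ('i \<times> 'a) option" where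
  "wedge_inj p = (\<lambda>(i, x). if x = p i then None else Some (i, x))"

definition wedge_topology ::
  "('i \<Rightarrow> 'a topology) \<Rightarrow> ('i \<Rightarrow> 'a) \<Rightarrow> 'i set \<Rightarrow> ('i \<times> 'a) option topology" where
  "wedge_topology X p I =
     topology (\<lambda>U. U \<subseteq> insert None (wedge_inj p ` (SIGMA i:I. topspace (X i))) \<and>
                   (\<forall>i\<in>I. openin (X i) {x \<in> topspace (X i). wedge_inj p (i, x) \<in> U}))"

lemma openin_wedge_topology:
  "openin (wedge_topology X p I) U \<longleftrightarrow>
     U \<subseteq> insert None (wedge_inj p ` (SIGMA i:I. topspace (X i))) \<and>
     (\<forall>i\<in>I. openin (X i) {x \<in> topspace (X i). wedge_inj p (i, x) \<in> U})"
proof -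
  have 1: "{x \<in> topspace (X i). wedge_inj p (i, x) \<in> S \<inter> T} =
      {x \<in> topspace (X i). wedge_inj p (i, x) \<in> S} \<inter> {x \<in> topspace (X i). wedge_inj p (i, x) \<in> T}"
    for i S T by auto
  have 2: "{x \<in> topspace (X i). wedge_inj p (i, x) \<in> \<Union>\<K>} =
      (\<Union>S\<in>\<K>. {x \<in> topspace (X i). wedge_inj p (i, x) \<in> S})" for i \<K> by auto
  have "istopology (\<lambda>U. U \<subseteq> insert None (wedge_inj p ` (SIGMA i:I. topspace (X i))) \<and>
                   (\<forall>i\<in>I. openin (X i) {x \<in> topspace (X i). wedge_inj p (i, x) \<in> U}))"
    unfolding istopology_def 1 2 by (intro conjI allI impI ballI openin_Int openin_Union) blast+
  then show ?thesis
    by (simp add: wedge_topology_def)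
qed

lemma topspace_wedge_topology:
  "topspace (wedge_topology X p I) = insert None (wedge_inj p ` (SIGMA i:I. topspace (X i)))"
proof -
  have "{x \<in> topspace (X i). wedge_inj p (i, x) \<in> insert None (wedge_inj p ` (SIGMA i:I. topspace (X i)))}
      = topspace (X i)" if "i \<in> I" for i using that by auto
  then have "openin (wedge_topology X p I) (insert None (wedge_inj p ` (SIGMA i:I. topspace (X i))))"
    by (simp add: openin_wedge_topology)
  then show ?thesis
    using openin_topspace[of "wedge_topology X p I"]
    by (intro subset_antisym openin_subset) (auto simp only: openin_wedge_topology)
qed

lemma quotient_map_wedge_inj:
  assumes "I \<noteq> {}" and "\<And>i. i \<in> I \<Longrightarrow> p i \<in> topspace (X i)"
  shows "quotient_map (sum_topology X I) (wedge_topology X p I) (wedge_inj p)"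
proof -
  obtain i where i: "i \<in> I" using assms(1) by blast
  have "None = wedge_inj p (i, p i)" by (simp add: wedge_inj_def)
  then have "None \<in> wedge_inj p ` (SIGMA i:I. topspace (X i))"
    using i assms(2) by blast
  moreover have "{x. (i, x) \<in> (SIGMA i:I. topspace (X i)) \<and> wedge_inj p (i, x) \<in> U} =
      {x \<in> topspace (X i). wedge_inj p (i, x) \<in> U}" if "i \<in> I" for i U
    using that by auto
  ultimately show ?thesis
    unfolding quotient_map_def openin_wedge_topology topspace_wedge_topology
    by (auto simp: openin_sum_topology topspace_sum_topology insert_absorb o_def)
qed

definition nsphere_base :: "nat \<Rightarrow> real" where
  "nsphere_base = (\<lambda>i. if i = 0 then 1 else 0)"

text \<open>\<open>X\<close> is homotopy equivalent to a wedge of \<open>m\<close> spheres, all of dimension \<open>d\<close>. A wedge of no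
  spheres is a point. Spheres of negative dimension are empty: the \<open>(-1)\<close>-sphere is the
  realization of the complex whose only face is empty, and the dimension \<open>-2\<close> is the usual
  convention for the order complex of \<open>(u, u)\<close>. Being empty they have no base points, so that the
  only wedge of them is a single one.\<close>

definition homotopic_to_wedge_of_spheres :: "'a topology \<Rightarrow> nat \<Rightarrow> int \<Rightarrow> bool" where
  "homotopic_to_wedge_of_spheres X m d \<longleftrightarrow>
     (if 0 \<le> d \<or> m = 0
      then X homotopy_equivalent_space
             wedge_topology (\<lambda>k::nat. nsphere (nat d)) (\<lambda>k. nsphere_base) {..<m}
      else m = 1 \<and> topspace X = {})"


section \<open>Generalized Chebyshev polynomials\<close>

text \<open>The upper index \<open>n - k - 1\<close> is negative only for \<open>n = k = 0\<close>, where the binomial coefficient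
  is read as 0, so that \<open>T\<^sup>s\<^sub>0 = 1\<close> (for \<open>s = 2\<close> these are the Chebyshev polynomials of the first
  kind). The exponent \<open>n - 2k - 1\<close> can be \<open>-1\<close>.\<close>

definition int_choose :: "int \<Rightarrow> nat \<Rightarrow> nat" where
  "int_choose a k = (if a < 0 then 0 else nat a choose k)"

definition gen_chebyshev :: "nat \<Rightarrow> nat \<Rightarrow> rat poly" where
  "gen_chebyshev s n =
     (\<Sum>k\<le>n div 2.
        monom ((- 1) ^ k * of_nat s powi (int n - 2 * int k - 1) *
               (of_nat (int_choose (int n - int k) k) * of_nat s
                - of_nat (int_choose (int n - int k - 1) k)))
              (n - 2 * k))"

end

theory Submission
  imports Defs "HOL-Library.Sublist"
begin

text \<open>A finite complex \<open>K\<close> is called spherical below if some \<open>m\<close> of its facets, all of the same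
  dimension \<open>d\<close>, can be deleted so that the rest arises from the void complex by elementary
  expansions. Coning off the rest does not change the homotopy type, and the result is a cone with
  \<open>m\<close> simplices of dimension \<open>d\<close> attached along their boundaries; contracting the cone to its apex
  gives a wedge of \<open>m\<close> spheres.

  Let \<open>T = s + 1\<close>. Removing all coatoms \<open>a T\<^sup>j\<^sup>-\<^sup>1\<close> with \<open>a \<le> s\<close> from \<open>(1\<^sup>i, T\<^sup>j)\<close> leaves a poset on which
  raising the first letter to \<open>T\<close> is a closure operator with a least fixed point, hence a
  contractible one. The coatoms are then put back one by one, and the link of \<open>a T\<^sup>j\<^sup>-\<^sup>1\<close> is
  \<open>(1\<^sup>i, a T\<^sup>j\<^sup>-\<^sup>1)\<close>. After removing \<open>T\<^sup>j\<^sup>-\<^sup>1\<close>, whose link is \<open>(1\<^sup>i, T\<^sup>j\<^sup>-\<^sup>1)\<close>, prepending \<open>a\<close> to the words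
  that do not begin with \<open>a\<close> is a closure operator on this link. Its fixed points have a least
  element, unless \<open>a = 1\<close> and \<open>i > 0\<close>, when they form a copy of \<open>(1\<^sup>i\<^sup>-\<^sup>1, T\<^sup>j\<^sup>-\<^sup>1)\<close>. So the number of
  spheres satisfies \<open>N(i, j) = s N(i, j - 1) + N(i - 1, j - 1)\<close>, as the Chebyshev coefficients do.\<close>

section \<open>Elementary expansions\<close>

text \<open>Both removals have one cause: a closure operator must stay inside the open interval.
  Raising the first letter of \<open>a T^(j-1)\<close> gives the top \<open>T^j\<close>, and
  prepending \<open>a\<close> to \<open>T^(j-1)\<close> gives the top of the link; no other element
  is sent to the top. Counts add up because every link put back is spherical in exactly one
  dimension less, and because the deleted facets have the largest size that ranks allow, so later
  expansions never rest on them. Each of the \<open>s\<close> coatoms receives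
  \<open>N(i, j-1)\<close> from the \<open>T^(j-1)\<close> in its link; only \<open>a = 1\<close>
  also receives \<open>N(i-1, j-1)\<close>. For \<open>i = j\<close> the only coatom above
  \<open>1^i\<close> is the one with \<open>a = 1\<close>. The topological obstacle is to turn the
  contraction of the cone into a homotopy equivalence with the wedge itself. The contraction is
  extended over the attached simplices by an explicit formula, so that it descends to the quotient;
  the quotient is identified with the wedge through explicit sphere coordinates, with compact source
  and Hausdorff target.\<close>

definition simplicial :: "'a set set \<Rightarrow> bool" where
  "simplicial K \<longleftrightarrow> finite K \<and> (\<forall>\<sigma>\<in>K. finite \<sigma> \<and> (\<forall>\<rho>\<subseteq>\<sigma>. \<rho> \<in> K))"

lemma simplicialD:
  assumes "simplicial K"
  shows "finite K" "\<sigma> \<in> K \<Longrightarrow> finite \<sigma>" "\<sigma> \<in> K \<Longrightarrow> \<rho> \<subseteq> \<sigma> \<Longrightarrow> \<rho> \<in> K"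
    "K \<noteq> {} \<Longrightarrow> {} \<in> K"
  using assms unfolding simplicial_def by blast+

text \<open>Expansions may start from the void complex: the first one then adds \<open>{}\<close> together with a
  vertex, so that \<open>expands {} K\<close> makes a nonempty \<open>K\<close> collapsible to a point.\<close>

inductive expands :: "'a set set \<Rightarrow> 'a set set \<Rightarrow> bool" for C where
  base: "simplicial C \<Longrightarrow> expands C C"
| step: "expands C K \<Longrightarrow> \<sigma> \<notin> K \<Longrightarrow> v \<notin> \<sigma> \<Longrightarrow> insert v \<sigma> \<notin> K \<Longrightarrow>
    simplicial (K \<union> {\<sigma>, insert v \<sigma>}) \<Longrightarrow> expands C (K \<union> {\<sigma>, insert v \<sigma>})"

lemma expands_simplicial: "expands C K \<Longrightarrow> simplicial K"
  by (induction rule: expands.induct) auto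

lemma expands_subset: "expands C K \<Longrightarrow> C \<subseteq> K"
  by (induction rule: expands.induct) auto

lemma expands_trans:
  assumes "expands K L" "expands C K" shows "expands C L"
  using assms by (induction rule: expands.induct) (blast intro: expands.step)+

text \<open>A member of \<open>F\<close> has \<open>n\<close> vertices, while the proper faces of a
  newly added simplex have fewer. So no expansion rests on \<open>F\<close>, and the same pairs can
  be added after \<open>F\<close> has been deleted.\<close>

lemma expands_diff:
  assumes "expands C K" "F \<subseteq> C" "simplicial (C - F)"
    and "\<forall>\<tau>\<in>F. card \<tau> = n" "\<forall>\<sigma>\<in>K. card \<sigma> \<le> n"
  shows "expands (C - F) (K - F)"
  using assms
proof (induction rule: expands.induct)
  case base
  then show ?case by (simp add: expands.base)
next
  case (step K \<sigma> v)
  have IH: "expands (C - F) (K - F)" using step by auto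
  have "F \<subseteq> K" using step expands_subset by blast
  then have eq: "K \<union> {\<sigma>, insert v \<sigma>} - F = (K - F) \<union> {\<sigma>, insert v \<sigma>}"
    using step.hyps by blast
  have fin: "finite (insert v \<sigma>)" using step.hyps(5) by (auto simp: simplicial_def)
  have "simplicial ((K - F) \<union> {\<sigma>, insert v \<sigma>})"
    unfolding simplicial_def
  proof (intro conjI ballI allI impI)
    show "finite (K - F \<union> {\<sigma>, insert v \<sigma>})"
      using IH expands_simplicial simplicialD(1) by blast
  next
    fix \<rho> assume "\<rho> \<in> K - F \<union> {\<sigma>, insert v \<sigma>}"
    then show "finite \<rho>" using step.hyps(5) by (auto simp: simplicial_def)
  next
    fix \<rho> \<pi> assume \<rho>: "\<rho> \<in> K - F \<union> {\<sigma>, insert v \<sigma>}" and \<pi>: "\<pi> \<subseteq> \<rho>"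
    show "\<pi> \<in> K - F \<union> {\<sigma>, insert v \<sigma>}"
    proof (cases "\<rho> \<in> K - F")
      case True
      then have "\<pi> \<in> K - F" using simplicialD(3)[OF expands_simplicial[OF IH] True \<pi>] by simp
      then show ?thesis by simp
    next
      case False
      then have "\<rho> \<subseteq> insert v \<sigma>" using \<rho> by auto
      then have sub: "\<pi> \<subseteq> insert v \<sigma>" using \<pi> by auto
      have in2: "\<pi> \<in> K \<union> {\<sigma>, insert v \<sigma>}"
        using simplicialD(3)[OF step.hyps(5) _ sub] by blast
      have "\<pi> \<notin> F" if "\<pi> \<noteq> insert v \<sigma>"
      proof
        assume "\<pi> \<in> F"
        then have "card \<pi> = n" using step by auto
        moreover have "card \<pi> < card (insert v \<sigma>)"
          using sub that fin by (intro psubset_card_mono) auto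
        ultimately show False using step.prems(4) by auto
      qed
      then show ?thesis using in2 by auto
    qed
  qed
  then show ?case unfolding eq
    using IH step.hyps by (intro expands.step) auto
qed

lemma simplicial_cone:
  assumes C: "simplicial C" and L: "simplicial L" and "L \<subseteq> C"
  shows "simplicial (C \<union> insert x ` L)"
  unfolding simplicial_def
proof (intro conjI ballI allI impI)
  show "finite (C \<union> insert x ` L)" using C L by (simp add: simplicial_def)
next
  fix \<sigma> assume "\<sigma> \<in> C \<union> insert x ` L"
  then show "finite \<sigma>" using C L by (auto simp: simplicial_def)
next
  fix \<sigma> \<rho> assume \<sigma>: "\<sigma> \<in> C \<union> insert x ` L" and \<rho>: "\<rho> \<subseteq> \<sigma>"
  show "\<rho> \<in> C \<union> insert x ` L"
  proof (cases "\<sigma> \<in> C")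
    case True
    then show ?thesis using C \<rho> by (auto simp: simplicial_def)
  next
    case False
    then obtain \<pi> where \<pi>: "\<pi> \<in> L" "\<sigma> = insert x \<pi>" using \<sigma> by blast
    have "\<rho> - {x} \<subseteq> \<pi>" using \<rho> \<pi> by auto
    then have "\<rho> - {x} \<in> L" using simplicialD(3)[OF L \<pi>(1)] by simp
    then show ?thesis
      using assms(3) by (cases "x \<in> \<rho>") (auto simp: image_iff insert_absorb intro!: bexI[of _ "\<rho> - {x}"])
  qed
qed

text \<open>A pair \<open>\<sigma>\<close>, \<open>insert v \<sigma>\<close> added to
  \<open>L\<close> lies in \<open>C\<close> already, so coning it with \<open>x\<close> gives a pair
  that can be added over \<open>C\<close>. With \<open>L0 = {}\<close>, attaching a cone over an
  \<open>L\<close> built from the void complex is itself a sequence of expansions.\<close>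

lemma expands_cone:
  assumes "expands L0 L" "simplicial C" "L \<subseteq> C" "x \<notin> \<Union>C"
  shows "expands (C \<union> insert x ` L0) (C \<union> insert x ` L)"
  using assms
proof (induction rule: expands.induct)
  case base
  then show ?case by (intro expands.base simplicial_cone) auto
next
  case (step L \<sigma> v)
  have IH: "expands (C \<union> insert x ` L0) (C \<union> insert x ` L)" using step by auto
  have \<sigma>C: "\<sigma> \<in> C" "insert v \<sigma> \<in> C" using step.prems by auto
  then have x: "x \<notin> \<sigma>" "x \<noteq> v" using step.prems by auto
  have new: "insert x \<rho> \<notin> C \<union> insert x ` L" if "\<rho> \<notin> L" "x \<notin> \<rho>" for \<rho>
  proof -
    have "x \<notin> \<pi>" if "\<pi> \<in> L" for \<pi> using that step.prems by auto
    then have "insert x \<rho> \<noteq> insert x \<pi>" if "\<pi> \<in> L" for \<pi>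
      using that \<open>\<rho> \<notin> L\<close> \<open>x \<notin> \<rho>\<close> by (metis insert_ident)
    then show ?thesis using step.prems(3) by blast
  qed
  have sc: "simplicial (C \<union> insert x ` (L \<union> {\<sigma>, insert v \<sigma>}))"
    using step by (intro simplicial_cone) auto
  have eq: "C \<union> insert x ` (L \<union> {\<sigma>, insert v \<sigma>}) =
      (C \<union> insert x ` L) \<union> {insert x \<sigma>, insert v (insert x \<sigma>)}"
    by (auto simp: insert_commute)
  have "insert v (insert x \<sigma>) \<notin> C \<union> insert x ` L"
    using new[of "insert v \<sigma>"] step.hyps x by (auto simp: insert_commute)
  then show ?case
    unfolding eq using IH step.hyps x sc new[of \<sigma>]
    by (intro expands.step) (auto simp only: eq insert_iff)
qed

text \<open>Faces are matched by adding \<open>v\<close>. If \<open>\<sigma>\<close> is a largest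
  face avoiding \<open>v\<close>, its only cofaces are \<open>\<sigma>\<close> and
  \<open>insert v \<sigma>\<close>, so this pair can be added last, and the rest still has apex
  \<open>v\<close>.\<close>

lemma expands_if_apex:
  assumes "simplicial K" "\<And>\<sigma>. \<sigma> \<in> K \<Longrightarrow> insert v \<sigma> \<in> K"
  shows "expands {} K"
  using assms
proof (induction "card K" arbitrary: K rule: less_induct)
  case less
  show ?case
  proof (cases "K = {}")
    case True
    then show ?thesis using less.prems by (auto intro: expands.base)
  next
    case False
    let ?S = "{\<sigma> \<in> K. v \<notin> \<sigma>}"
    have finK: "finite K" and fin: "\<And>\<sigma>. \<sigma> \<in> K \<Longrightarrow> finite \<sigma>"
      using less.prems by (auto simp: simplicial_def)
    have "{} \<in> ?S" using simplicialD(4)[OF less.prems(1) False] by simp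
    then have "Max (card ` ?S) \<in> card ` ?S" using finK by (intro Max_in) auto
    then obtain \<sigma> where \<sigma>: "\<sigma> \<in> ?S" "Max (card ` ?S) = card \<sigma>"
      unfolding image_iff by blast
    have max: "card \<rho> \<le> card \<sigma>" if "\<rho> \<in> ?S" for \<rho>
      unfolding \<sigma>(2)[symmetric] using finK that by (intro Max_ge) auto
    let ?K = "K - {\<sigma>, insert v \<sigma>}"
    have ins: "insert v \<sigma> \<in> K" using \<sigma> less.prems by auto
    have big: "\<rho> \<in> {\<sigma>, insert v \<sigma>}" if \<rho>: "\<rho> \<in> K" "\<sigma> \<subseteq> \<rho>" for \<rho>
    proof -
      have "\<rho> - {v} \<in> K" using simplicialD(3)[OF less.prems(1)] \<rho> by blast
      then have "card (\<rho> - {v}) \<le> card \<sigma>" using max by blast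
      moreover have "\<sigma> \<subseteq> \<rho> - {v}" using \<rho> \<sigma> by auto
      ultimately have "\<rho> - {v} = \<sigma>" using fin \<rho> by (metis card_seteq finite_Diff)
      then show ?thesis by auto
    qed
    have sK: "simplicial ?K"
      unfolding simplicial_def
    proof (intro conjI ballI allI impI)
      show "finite ?K" using finK by simp
      fix \<rho> assume \<rho>: "\<rho> \<in> ?K"
      then show "finite \<rho>" using fin by simp
      fix \<pi> assume "\<pi> \<subseteq> \<rho>"
      then show "\<pi> \<in> ?K" using \<rho> big[of \<rho>] simplicialD(3)[OF less.prems(1), of \<rho> \<pi>] by blast
    qed
    have "card ?K < card K" using \<sigma> finK by (intro psubset_card_mono) auto
    moreover have "insert v \<rho> \<in> ?K" if "\<rho> \<in> ?K" for \<rho>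
    proof -
      have "insert v \<rho> \<noteq> insert v \<sigma>"
        using that \<sigma>(1) by (cases "v \<in> \<rho>") (simp_all add: insert_absorb insert_ident)
      moreover have "insert v \<rho> \<noteq> \<sigma>" using \<sigma>(1) by blast
      ultimately show ?thesis using that less.prems(2)[of \<rho>] by simp
    qed
    ultimately have "expands {} ?K" using sK less.hyps by blast
    moreover have eq: "?K \<union> {\<sigma>, insert v \<sigma>} = K" using \<sigma> ins by blast
    ultimately have "expands {} (?K \<union> {\<sigma>, insert v \<sigma>})"
      using \<sigma> less.prems(1) by (intro expands.step) (simp_all only: eq, auto)
    then show ?thesis unfolding eq .
  qed
qed

lemma simplicial_image:
  assumes "simplicial K" shows "simplicial ((`) f ` K)"
  using assms unfolding simplicial_def
  by (auto simp: subset_image_iff)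

lemma expands_image:
  assumes "expands C K" "inj_on f (\<Union>K)"
  shows "expands ((`) f ` C) ((`) f ` K)"
  using assms
proof (induction rule: expands.induct)
  case base
  then show ?case by (intro expands.base simplicial_image)
next
  case (step K \<sigma> v)
  have "inj_on f (\<Union>K)" using step.prems by (rule inj_on_subset) auto
  then have IH: "expands ((`) f ` C) ((`) f ` K)" using step.IH by simp
  have new: "f ` \<rho> \<notin> (`) f ` K" if "\<rho> \<notin> K" "\<rho> \<subseteq> insert v \<sigma>" for \<rho>
  proof
    assume "f ` \<rho> \<in> (`) f ` K"
    then obtain \<pi> where \<pi>: "\<pi> \<in> K" "f ` \<rho> = f ` \<pi>" by (elim imageE)
    have "\<rho> \<subseteq> \<Union>(K \<union> {\<sigma>, insert v \<sigma>})" "\<pi> \<subseteq> \<Union>(K \<union> {\<sigma>, insert v \<sigma>})"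
      using \<pi>(1) that(2) by auto
    then have "\<rho> = \<pi>" using inj_on_image_eq_iff[OF step.prems] \<pi>(2) by simp
    then show False using \<pi>(1) that(1) by simp
  qed
  have "inj_on f (insert v \<sigma>)" using step.prems by (rule inj_on_subset) blast
  then have v: "f v \<notin> f ` \<sigma>" using step.hyps(3) by simp
  have eq: "(`) f ` (K \<union> {\<sigma>, insert v \<sigma>}) = ((`) f ` K) \<union> {f ` \<sigma>, insert (f v) (f ` \<sigma>)}"
    by (simp add: image_Un)
  have "simplicial (((`) f ` K) \<union> {f ` \<sigma>, insert (f v) (f ` \<sigma>)})"
    using simplicial_image[OF step.hyps(5), of f] unfolding eq .
  moreover have "f ` \<sigma> \<notin> (`) f ` K" by (rule new) (use step.hyps in auto)
  moreover have "insert (f v) (f ` \<sigma>) \<notin> (`) f ` K"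
    using new[of "insert v \<sigma>"] step.hyps(4) by simp
  ultimately show ?case unfolding eq using expands.step[OF IH _ v] by simp
qed

section \<open>Spherical complexes and how they grow\<close>

definition spherical :: "nat \<Rightarrow> nat \<Rightarrow> 'a set set \<Rightarrow> bool" where
  "spherical m n K \<longleftrightarrow> simplicial K \<and>
     (\<exists>F\<subseteq>K. card F = m \<and> (\<forall>\<tau>\<in>F. card \<tau> = n) \<and> expands {} (K - F))"

lemma spherical_simplicial: "spherical m n K \<Longrightarrow> simplicial K"
  by (simp add: spherical_def)

lemma spherical_0: "expands {} K \<Longrightarrow> spherical 0 n K"
  unfolding spherical_def by (auto intro!: exI[of _ "{}"] dest: expands_simplicial)

text \<open>The parameter \<open>n\<close> of \<open>spherical\<close> counts vertices, so the
  spheres have dimension \<open>n - 1\<close>. Here the deleted facet is the empty face and the void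
  complex remains: a single (-1)-sphere. It enters the recursion as the order complex of an empty
  interval or link.\<close>

lemma spherical_empty_face: "spherical 1 0 {{}}"
  unfolding spherical_def
  by (auto intro!: exI[of _ "{{}}"] expands.base simp: simplicial_def)

text \<open>Expansions that create no simplex with more than \<open>n\<close> vertices leave the
  facets deleted from \<open>C\<close> maximal, so they can be deleted from \<open>K\<close> as
  well.\<close>

lemma spherical_expands:
  assumes "spherical m n C" "expands C K" "\<forall>\<sigma>\<in>K. card \<sigma> \<le> n"
  shows "spherical m n K"
proof -
  obtain F where F: "F \<subseteq> C" "card F = m" "\<forall>\<tau>\<in>F. card \<tau> = n" "expands {} (C - F)"
    using assms by (auto simp: spherical_def)
  have "expands (C - F) (K - F)"
    by (rule expands_diff[OF assms(2) F(1) expands_simplicial[OF F(4)] F(3) assms(3)])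
  then have "expands {} (K - F)" by (rule expands_trans[OF _ F(4)])
  moreover have "F \<subseteq> K" using F(1) expands_subset[OF assms(2)] by (rule subset_trans)
  ultimately show ?thesis
    unfolding spherical_def using F(2,3) expands_simplicial[OF assms(2)] by (intro conjI exI[of _ F])
qed

lemma spherical_image:
  assumes "spherical m n K" "inj_on f (\<Union>K)"
  shows "spherical m n ((`) f ` K)"
proof -
  obtain F where F: "F \<subseteq> K" "card F = m" "\<forall>\<tau>\<in>F. card \<tau> = n" "expands {} (K - F)"
    using assms by (auto simp: spherical_def)
  have inj: "inj_on ((`) f) K"
  proof (rule inj_onI)
    fix \<sigma> \<tau> assume "\<sigma> \<in> K" "\<tau> \<in> K" "f ` \<sigma> = f ` \<tau>"
    then show "\<sigma> = \<tau>" using inj_on_image_eq_iff[OF assms(2), of \<sigma> \<tau>] by (simp add: Union_upper)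
  qed
  have "inj_on f (\<Union>(K - F))" using assms(2) by (rule inj_on_subset) auto
  then have "expands {} ((`) f ` (K - F))" using expands_image[OF F(4)] by simp
  moreover have "(`) f ` (K - F) = (`) f ` K - (`) f ` F"
    using inj_on_image_set_diff[OF inj _ F(1), of K] by simp
  moreover have "card ((`) f ` F) = m"
    using card_image[OF inj_on_subset[OF inj F(1)]] F(2) by simp
  moreover have "card (f ` \<tau>) = n" if "\<tau> \<in> F" for \<tau>
  proof -
    have "inj_on f \<tau>" using assms(2) by (rule inj_on_subset) (use F that in auto)
    then show ?thesis using F that by (simp add: card_image)
  qed
  ultimately show ?thesis
    unfolding spherical_def using F(1) simplicial_image spherical_simplicial[OF assms(1)]
    by (intro conjI exI[of _ "(`) f ` F"]) auto
qed

text \<open>Each facet \<open>\<tau>\<close> deleted from the link \<open>L\<close> yields a facet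
  \<open>insert x \<tau>\<close> to delete; the rest of the cone has base \<open>L - G\<close> and
  is attached by expansions. The dimensions must match exactly: \<open>n = Suc n'\<close> makes old
  and new facets equally large.\<close>

lemma spherical_cone:
  assumes C: "spherical m n C" and L: "spherical m' n' L" and n: "n = Suc n'"
    and "L \<subseteq> C" and dim: "\<forall>\<sigma>\<in>L. card \<sigma> \<le> n'" and x: "x \<notin> \<Union>C"
  shows "spherical (m + m') n (C \<union> insert x ` L)"
proof -
  obtain F where F: "F \<subseteq> C" "card F = m" "\<forall>\<tau>\<in>F. card \<tau> = n" "expands {} (C - F)"
    using C by (auto simp: spherical_def)
  obtain G where G: "G \<subseteq> L" "card G = m'" "\<forall>\<tau>\<in>G. card \<tau> = n'" "expands {} (L - G)"
    using L by (auto simp: spherical_def)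
  have fin: "finite C" "finite L" "\<And>\<sigma>. \<sigma> \<in> L \<Longrightarrow> finite \<sigma>"
    using C L by (auto simp: spherical_def simplicial_def)
  \<comment> \<open>Members of \<open>F\<close> have \<open>Suc n'\<close> vertices, too many for
    \<open>L\<close>, so the base of the remaining cone survives the deletion of
    \<open>F\<close>.\<close>
  have "L - G \<subseteq> C - F" using dim F(3) n \<open>L \<subseteq> C\<close> by fastforce
  then have "expands ((C - F) \<union> insert x ` {}) ((C - F) \<union> insert x ` (L - G))"
    using x F(4) G(4) by (intro expands_cone) (auto dest: expands_simplicial)
  then have ex: "expands {} ((C - F) \<union> insert x ` (L - G))"
    using F(4) expands_trans by (metis image_empty sup_bot.right_neutral)
  have xL: "x \<notin> \<sigma>" if "\<sigma> \<in> L" for \<sigma> using x that \<open>L \<subseteq> C\<close> by auto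
  then have inj: "inj_on (insert x) L" by (meson inj_onI insert_ident)
  have notC: "insert x \<sigma> \<notin> C" for \<sigma> using x by auto
  have "C \<union> insert x ` L - (F \<union> insert x ` G) = (C - F) \<union> (insert x ` L - insert x ` G)"
    using notC F(1) by auto
  then have eq: "C \<union> insert x ` L - (F \<union> insert x ` G) = (C - F) \<union> insert x ` (L - G)"
    using inj_on_image_set_diff[OF inj _ G(1), of L] by simp
  have "card (F \<union> insert x ` G) = m + m'"
  proof -
    have "card (insert x ` G) = m'"
      using card_image[OF inj_on_subset[OF inj G(1)]] G(2) by simp
    moreover have "F \<inter> insert x ` G = {}" using notC F(1) by auto
    moreover have "finite F" "finite G" using F(1) G(1) fin finite_subset by blast+
    ultimately show ?thesis using F(2) by (simp add: card_Un_disjoint)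
  qed
  moreover have "card \<tau> = n" if "\<tau> \<in> F \<union> insert x ` G" for \<tau>
    using that F(3) G(1,3) fin(3) xL n by (auto simp: subset_iff)
  ultimately show ?thesis
    unfolding spherical_def
    using ex eq F(1) G(1) simplicial_cone[OF C[THEN spherical_simplicial] L[THEN spherical_simplicial] \<open>L \<subseteq> C\<close>]
    by (intro conjI exI[of _ "F \<union> insert x ` G"]) auto
qed


section \<open>Geometric realizations\<close>

definition geo :: "'a set set \<Rightarrow> ('a \<Rightarrow> real) set" where
  "geo K = {x. (\<forall>v. 0 \<le> x v) \<and> {v. x v \<noteq> 0} \<in> K \<and> (\<Sum>v | x v \<noteq> 0. x v) = 1}"

lemma geometric_realization_eq: "geometric_realization K = top_of_set (geo K)"
  by (simp add: geometric_realization_def geo_def euclidean_product_topology)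

lemma geoD:
  assumes "x \<in> geo K"
  shows "0 \<le> x v" "{v. x v \<noteq> 0} \<in> K"
  using assms by (auto simp: geo_def)

lemma geo_sum:
  assumes "x \<in> geo K" "finite V" "{v. x v \<noteq> 0} \<subseteq> V"
  shows "sum x V = 1"
proof -
  have "sum x V = (\<Sum>v | x v \<noteq> 0. x v)"
    using assms(2,3) by (intro sum.mono_neutral_right) auto
  then show ?thesis using assms(1) by (simp add: geo_def)
qed

lemma geoI:
  assumes "\<And>v. 0 \<le> x v" "{v. x v \<noteq> 0} \<in> K" "finite V" "{v. x v \<noteq> 0} \<subseteq> V" "sum x V = 1"
  shows "x \<in> geo K"
proof -
  have "sum x V = (\<Sum>v | x v \<noteq> 0. x v)"
    using assms(3,4) by (intro sum.mono_neutral_right) auto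
  then show ?thesis using assms by (simp add: geo_def)
qed

lemma continuous_on_Min_image:
  fixes f :: "'b \<Rightarrow> 'a::topological_space \<Rightarrow> real"
  assumes "finite A" "A \<noteq> {}" "\<And>a. a \<in> A \<Longrightarrow> continuous_on S (f a)"
  shows "continuous_on S (\<lambda>x. Min ((\<lambda>a. f a x) ` A))"
  using assms
proof (induction A rule: finite_ne_induct)
  case (insert a A)
  then have "continuous_on S (\<lambda>x. min (f a x) (Min ((\<lambda>a. f a x) ` A)))"
    by (intro continuous_intros) auto
  then show ?case using insert by simp
qed auto

lemma continuous_on_coordinate:
  fixes S :: "('a \<Rightarrow> 'b::topological_space) set"
  shows "continuous_on S (\<lambda>x. x u)"
  by (rule continuous_on_product_then_coordinatewise) (rule continuous_on_id)

lemma continuous_on_snd_coordinate: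
  fixes S :: "('c::topological_space \<times> ('a \<Rightarrow> 'b::topological_space)) set"
  shows "continuous_on S (\<lambda>p. snd p u)"
  by (rule continuous_on_product_then_coordinatewise) (rule continuous_on_snd[OF continuous_on_id])

lemma homotopic_with_top_of_set_id:
  fixes h :: "real \<times> 'b::topological_space \<Rightarrow> 'b"
  assumes "continuous_on ({0..1} \<times> S) h" "\<And>t x. t \<in> {0..1} \<Longrightarrow> x \<in> S \<Longrightarrow> h (t, x) \<in> S"
    "\<And>x. x \<in> S \<Longrightarrow> h (0, x) = x"
  shows "homotopic_with (\<lambda>x. True) (top_of_set S) (top_of_set S) (\<lambda>x. h (1, x)) id"
proof -
  have "homotopic_with (\<lambda>x. True) (top_of_set S) (top_of_set S) id (\<lambda>x. h (1, x))"
    using assms by (subst homotopic_with) (auto intro!: exI[of _ h])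
  then show ?thesis by (rule homotopic_with_symD)
qed

text \<open>The simplex \<open>insert v \<sigma>\<close> is pushed away from its free face \<open>\<sigma>\<close>: all coordinates in \<open>\<sigma>\<close> are
  lowered at the same rate until one of them vanishes, and \<open>v\<close> gains the mass.\<close>

lemma elementary_expansion_homotopy_equivalent:
  fixes K :: "'a set set"
  assumes K: "simplicial K" "K \<noteq> {}" and \<sigma>: "\<sigma> \<notin> K" "v \<notin> \<sigma>" "insert v \<sigma> \<notin> K"
    and K2: "simplicial (K \<union> {\<sigma>, insert v \<sigma>})"
  shows "geometric_realization (K \<union> {\<sigma>, insert v \<sigma>}) homotopy_equivalent_space geometric_realization K"
proof -
  let ?K = "K \<union> {\<sigma>, insert v \<sigma>}"
  \<comment> \<open>\<open>\<sigma>\<close> is nonempty because \<open>{}\<close> lies in the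
    nonvoid \<open>K\<close>. The one expansion that changes the homotopy type, from the void
    complex to a point, is thereby excluded.\<close>
  have fin: "finite \<sigma>" and ne: "\<sigma> \<noteq> {}"
    using simplicialD(2)[OF K2, of \<sigma>] simplicialD(4)[OF K] \<sigma>(1) by auto
  define M where "M x = Min (x ` \<sigma>)" for x :: "'a \<Rightarrow> real"
  \<comment> \<open>The values of \<open>g\<close> sum to 0 over \<open>insert v \<sigma>\<close>,
    so moving along \<open>g\<close> preserves the total mass; at time 1 the smallest coordinate in
    \<open>\<sigma>\<close> has reached 0.\<close>
  define g where "g u = (if u \<in> \<sigma> then - 1 else if u = v then real (card \<sigma>) else 0)" for u
  define h where "h p = (\<lambda>u. snd p u + fst p * M (snd p) * g u)" for p :: "real \<times> ('a \<Rightarrow> real)"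
  have sumg: "sum g (insert v \<sigma>) = 0"
    using fin \<sigma>(2) by (simp add: g_def sum_negf)
  have Mle: "M x \<le> x u" if "u \<in> \<sigma>" for x u
    unfolding M_def using fin that by simp
  have Mex: "\<exists>u\<in>\<sigma>. M x = x u" for x
  proof -
    have "M x \<in> x ` \<sigma>" unfolding M_def using fin ne by (intro Min_in) auto
    then show ?thesis by auto
  qed
  have M0: "0 \<le> M x" if "x \<in> geo ?K" for x
    using Mex[of x] geoD(1)[OF that] by metis
  have supp: "{u. x u \<noteq> 0} \<in> {\<sigma>, insert v \<sigma>}" if "x \<in> geo ?K" "M x \<noteq> 0" for x
  proof -
    have "\<sigma> \<subseteq> {u. x u \<noteq> 0}" using Mle[of _ x] M0[OF that(1)] that(2) by force
    then have "{u. x u \<noteq> 0} \<notin> K" using simplicialD(3)[OF K(1)] \<sigma>(1) by metis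
    then show ?thesis using geoD(2)[OF that(1)] by auto
  qed
  have sub: "\<rho> \<in> ?K" if "\<rho> \<subseteq> insert v \<sigma>" for \<rho>
    by (rule simplicialD(3)[OF K2 _ that]) simp
  have h_supp: "{u. h (t, x) u \<noteq> 0} \<subseteq> insert v \<sigma>" if "x \<in> geo ?K" "M x \<noteq> 0" for t x
    using supp[OF that] by (auto simp: h_def g_def split: if_splits)
  have h_nonneg: "0 \<le> h (t, x) u" if "t \<in> {0..1}" "x \<in> geo ?K" for t x u
  proof -
    have "t * M x \<le> 1 * x u" if "u \<in> \<sigma>"
      using that \<open>t \<in> {0..1}\<close> M0[OF \<open>x \<in> geo ?K\<close>] Mle[OF that] by (intro mult_mono) auto
    then show ?thesis
      using that M0[OF that(2)] geoD(1)[OF that(2)] by (auto simp: h_def g_def)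
  qed
  have h_sum: "sum (h (t, x)) (insert v \<sigma>) = 1" if "x \<in> geo ?K" "M x \<noteq> 0" for t x
  proof -
    have "sum (h (t, x)) (insert v \<sigma>) = sum x (insert v \<sigma>) + t * M x * sum g (insert v \<sigma>)"
      by (simp only: h_def fst_conv snd_conv sum.distrib sum_distrib_left)
    also have "sum x (insert v \<sigma>) = 1"
      using supp[OF that] fin by (intro geo_sum[OF that(1)]) auto
    finally show ?thesis using sumg by simp
  qed
  have h_triv: "h (t, x) = x" if "M x = 0" for t x using that by (simp add: h_def)
  have h_in: "h (t, x) \<in> geo ?K" if "t \<in> {0..1}" "x \<in> geo ?K" for t x
  proof (cases "M x = 0")
    case True
    then show ?thesis using that h_triv by simp
  next
    case False
    show ?thesis
      using h_supp[OF that(2) False, of t] h_nonneg[OF that] h_sum[OF that(2) False, of t] fin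
      by (intro geoI[where V = "insert v \<sigma>"] sub) auto
  qed
  have h1_in: "h (1, x) \<in> geo K" if x: "x \<in> geo ?K" for x
  proof (cases "M x = 0")
    case True
    then obtain u where "u \<in> \<sigma>" "x u = 0" using Mex[of x] by auto
    then have "{u. x u \<noteq> 0} \<in> K" using geoD(2)[OF x] by auto
    then show ?thesis using x True h_triv by (simp add: geo_def)
  next
    case False
    obtain u where u: "u \<in> \<sigma>" "M x = x u" using Mex by auto
    then have "h (1, x) u = 0" by (simp add: h_def g_def)
    then have "{u. h (1, x) u \<noteq> 0} \<notin> {\<sigma>, insert v \<sigma>}" using u(1) by auto
    moreover have "{u. h (1, x) u \<noteq> 0} \<in> ?K" by (rule sub[OF h_supp[OF x False]])
    ultimately have "{u. h (1, x) u \<noteq> 0} \<in> K" by auto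
    then show ?thesis
      using h_supp[OF x False, of 1] h_nonneg[of 1 x] h_sum[OF x False, of 1] fin x
      by (intro geoI[where V = "insert v \<sigma>"]) auto
  qed
  have h1_id: "h (1, x) = x" if "x \<in> geo K" for x
  proof -
    have "\<not> \<sigma> \<subseteq> {u. x u \<noteq> 0}"
      using simplicialD(3)[OF K(1) geoD(2)[OF that]] \<sigma>(1) by blast
    then obtain u where "u \<in> \<sigma>" "x u = 0" by auto
    moreover have "x \<in> geo ?K" using that by (simp add: geo_def)
    ultimately have "M x = 0" using Mle[of u x] M0[of x] by simp
    then show ?thesis by (rule h_triv)
  qed
  have "continuous_on S M" for S
    unfolding M_def using fin ne
    by (intro continuous_on_Min_image continuous_on_coordinate)
  then have "continuous_on S (\<lambda>p. M (snd p))" for S :: "(real \<times> ('a \<Rightarrow> real)) set"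
    by (rule continuous_on_compose2[OF _ continuous_on_snd[OF continuous_on_id]]) auto
  then have cont: "continuous_on S h" for S
    unfolding h_def
    by (intro continuous_on_coordinatewise_then_product continuous_on_add continuous_on_mult
        continuous_on_const continuous_on_fst continuous_on_id continuous_on_snd_coordinate)
  have "continuous_on S (\<lambda>x. h (1, x))" for S
    by (rule continuous_on_compose2[OF cont[of UNIV]]) (auto intro!: continuous_intros)
  moreover have "homotopic_with (\<lambda>x. True) (top_of_set (geo ?K)) (top_of_set (geo ?K))
      (\<lambda>x. h (1, x)) id"
    using cont h_in by (intro homotopic_with_top_of_set_id) (auto simp: h_def)
  moreover have "geo K \<subseteq> geo ?K" by (auto simp: geo_def)
  ultimately have "top_of_set (geo ?K) homotopy_equivalent_space top_of_set (geo K)"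
    using h1_in h1_id
    by (intro deformation_retract_imp_homotopy_equivalent_space[where r = "\<lambda>x. h (1, x)"])
       (auto simp: retraction_maps_def)
  then show ?thesis by (simp add: geometric_realization_eq)
qed

lemma expands_homotopy_equivalent:
  assumes "expands C K" "C \<noteq> {}"
  shows "geometric_realization K homotopy_equivalent_space geometric_realization C"
  using assms
proof (induction rule: expands.induct)
  case base
  then show ?case by (simp add: homotopy_equivalent_space_refl)
next
  case (step K \<sigma> v)
  have "K \<noteq> {}" using expands_subset[OF step.hyps(1)] step.prems by auto
  then have "geometric_realization (K \<union> {\<sigma>, insert v \<sigma>}) homotopy_equivalent_space geometric_realization K"
    using step.hyps expands_simplicial by (intro elementary_expansion_homotopy_equivalent) blast+
  then show ?case using step.IH[OF step.prems] homotopy_eqv_trans by blast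
qed

text \<open>At time 1 the homotopy is constant on the fibres of \<open>f\<close>, so it factors as
  \<open>g \<circ> f\<close>, and \<open>g\<close> is the homotopy inverse. At every time it
  respects the fibres, so \<open>f \<circ> h\<close> descends to a homotopy on \<open>X\<close>; for
  this the product of \<open>f\<close> with the interval must again be a quotient map, which holds
  as its source is compact and its target Hausdorff.\<close>

lemma homotopy_equivalent_space_quotient:
  assumes Y: "compact_space Y" and X: "Hausdorff_space X"
    and f: "continuous_map Y X f" and surj: "f ` topspace Y = topspace X"
    and h: "continuous_map (prod_topology (top_of_set {0..1::real}) Y) Y h"
    and h0: "\<And>y. y \<in> topspace Y \<Longrightarrow> h (0, y) = y"
    and fib1: "\<And>y y'. y \<in> topspace Y \<Longrightarrow> y' \<in> topspace Y \<Longrightarrow> f y = f y' \<Longrightarrow> h (1, y) = h (1, y')"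
    and fib: "\<And>t y y'. t \<in> {0..1} \<Longrightarrow> y \<in> topspace Y \<Longrightarrow> y' \<in> topspace Y \<Longrightarrow> f y = f y' \<Longrightarrow>
      f (h (t, y)) = f (h (t, y'))"
  shows "Y homotopy_equivalent_space X"
proof -
  let ?I = "top_of_set {0..1::real}"
  have q: "quotient_map Y X f"
    using Y X f surj
    by (intro continuous_closed_imp_quotient_map continuous_imp_closed_map_gen Hausdorff_imp_kc_space)
  have h1: "continuous_map Y Y (h \<circ> Pair 1)" by (rule continuous_map_o_Pair[OF h]) simp
  obtain g where g: "continuous_map X Y g" "\<And>y. y \<in> topspace Y \<Longrightarrow> g (f y) = h (1, y)"
  proof (rule quotient_map_lift_exists[OF q h1])
    show "(h \<circ> Pair 1) y = (h \<circ> Pair 1) y'"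
      if "y \<in> topspace Y" "y' \<in> topspace Y" "f y = f y'" for y y'
      using fib1[OF that] by simp
  qed simp
  let ?f = "\<lambda>p. (fst p, f (snd p))"
  have cf: "continuous_map (prod_topology ?I Y) (prod_topology ?I X) ?f"
    by (intro continuous_map_pairedI continuous_map_fst continuous_map_compose[OF continuous_map_snd f, unfolded o_def])
  have "compact_space ?I" by (simp add: compact_space_subtopology)
  moreover have "Hausdorff_space ?I"
    by (simp add: Hausdorff_space_subtopology)
  moreover have sf: "?f ` topspace (prod_topology ?I Y) = topspace (prod_topology ?I X)"
  proof -
    have "topspace (prod_topology ?I X) = {0..1} \<times> f ` topspace Y" by (simp add: surj)
    also have "\<dots> = ?f ` ({0..1} \<times> topspace Y)" by force
    finally show ?thesis by simp
  qed
  ultimately have qf: "quotient_map (prod_topology ?I Y) (prod_topology ?I X) ?f"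
    using Y X cf
    by (intro continuous_closed_imp_quotient_map continuous_imp_closed_map_gen Hausdorff_imp_kc_space)
      (simp_all add: compact_space_prod_topology Hausdorff_space_prod_topology)
  have fh: "continuous_map (prod_topology ?I Y) X (f \<circ> h)" by (rule continuous_map_compose[OF h f])
  obtain k where k: "continuous_map (prod_topology ?I X) X k"
    "\<And>p. p \<in> topspace (prod_topology ?I Y) \<Longrightarrow> k (?f p) = (f \<circ> h) p"
  proof (rule quotient_map_lift_exists[OF qf fh])
    show "(f \<circ> h) p = (f \<circ> h) p'"
      if "p \<in> topspace (prod_topology ?I Y)" "p' \<in> topspace (prod_topology ?I Y)" "?f p = ?f p'" for p p'
      using that fib[of "fst p" "snd p" "snd p'"] by (cases p; cases p') simp
  next
    fix k assume "continuous_map (prod_topology ?I X) X k"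
      "\<And>p. p \<in> topspace (prod_topology ?I Y) \<Longrightarrow> k (?f p) = (f \<circ> h) p"
    then show thesis by (rule that)
  qed
  have k': "k (t, f y) = f (h (t, y))" if "t \<in> {0..1}" "y \<in> topspace Y" for t y
    using k(2)[of "(t, y)"] that by simp
  have "homotopic_with (\<lambda>x. True) Y Y id (g \<circ> f)"
  proof (subst homotopic_with, simp, intro exI[of _ h] conjI ballI h)
    fix y assume "y \<in> topspace Y"
    then show "h (0, y) = id y" "h (1, y) = (g \<circ> f) y" using h0 g(2) by simp_all
  qed simp
  moreover have "homotopic_with (\<lambda>x. True) X X id (f \<circ> g)"
  proof (subst homotopic_with, simp, intro exI[of _ k] conjI ballI)
    show "continuous_map (prod_topology ?I X) X k" by (rule k)
    fix x assume "x \<in> topspace X"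
    then obtain y where y: "y \<in> topspace Y" "x = f y" using surj by auto
    show "k (0, x) = id x" using k'[of 0 y] y h0 by simp
    show "k (1, x) = (f \<circ> g) x" using k'[of 1 y] y g(2) by simp
  qed simp
  ultimately show ?thesis
    unfolding homotopy_equivalent_space_def
    by (intro exI[of _ f] exI[of _ g] conjI f g(1)) (rule homotopic_with_symD, assumption)+
qed

text \<open>The realization is a finite union of closed simplices, each a closed subset of a product
  of unit intervals. The product is indexed by the whole vertex type and compact by
  Tychonoff.\<close>

lemma compact_geo:
  assumes K: "simplicial K"
  shows "compact (geo K)"
proof -
  let ?G = "\<lambda>\<sigma>. {x. (\<forall>v. 0 \<le> x v) \<and> (\<forall>v. v \<notin> \<sigma> \<longrightarrow> x v = 0) \<and> sum x \<sigma> = (1::real)}"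
  have eq: "geo K = (\<Union>\<sigma>\<in>K. ?G \<sigma>)"
  proof (intro subset_antisym subsetI)
    fix x assume x: "x \<in> geo K"
    show "x \<in> (\<Union>\<sigma>\<in>K. ?G \<sigma>)"
      by (rule UN_I[OF geoD(2)[OF x]]) (use x in \<open>auto simp: geo_def\<close>)
  next
    fix x assume "x \<in> (\<Union>\<sigma>\<in>K. ?G \<sigma>)"
    then obtain \<sigma> where \<sigma>: "\<sigma> \<in> K" "x \<in> ?G \<sigma>" by blast
    then have "{v. x v \<noteq> 0} \<subseteq> \<sigma>" by auto
    then show "x \<in> geo K"
      using \<sigma> simplicialD(2,3)[OF K \<sigma>(1)] by (intro geoI[of x K \<sigma>]) auto
  qed
  have "compact (?G \<sigma>)" if "\<sigma> \<in> K" for \<sigma>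
  proof -
    have fin: "finite \<sigma>" using simplicialD(2)[OF K that] .
    have "compact (Pi\<^sub>E UNIV (\<lambda>_. {0..1::real}) :: ('a \<Rightarrow> real) set)"
      using compactin_PiE[of "\<lambda>_. euclideanreal" UNIV "\<lambda>_. {0..1}"]
      by (simp add: euclidean_product_topology)
    moreover have "closed (?G \<sigma>)"
    proof -
      have "closed {x::'a \<Rightarrow> real. 0 \<le> x v}" for v
        by (intro closed_Collect_le continuous_on_const continuous_on_coordinate)
      moreover have "closed {x::'a \<Rightarrow> real. x v = 0}" for v
        by (intro closed_Collect_eq continuous_on_const continuous_on_coordinate)
      moreover have "closed {x::'a \<Rightarrow> real. sum x \<sigma> = 1}"
        by (intro closed_Collect_eq continuous_on_sum continuous_on_const continuous_on_coordinate)
      ultimately show ?thesis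
        by (intro closed_Collect_conj closed_Collect_all closed_Collect_imp) auto
    qed
    moreover have "?G \<sigma> \<subseteq> Pi\<^sub>E UNIV (\<lambda>_. {0..1})"
    proof (intro subsetI PiE_I)
      fix x v assume x: "x \<in> ?G \<sigma>"
      have "x v \<le> sum x \<sigma>" if "v \<in> \<sigma>" using x fin that by (intro member_le_sum) auto
      then show "x v \<in> {0..1}" using x by (cases "v \<in> \<sigma>") auto
    qed auto
    ultimately have "compact (Pi\<^sub>E UNIV (\<lambda>_. {0..1}) \<inter> ?G \<sigma>)" "Pi\<^sub>E UNIV (\<lambda>_. {0..1}) \<inter> ?G \<sigma> = ?G \<sigma>"
      by (blast intro: compact_Int_closed)+
    then show ?thesis by simp
  qed
  then show ?thesis unfolding eq using simplicialD(1)[OF K] by (intro compact_UN) auto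
qed


section \<open>Collapsing a simplex boundary to a point\<close>

text \<open>With \<open>m\<close> the minimal coordinate, \<open>z / m\<close> identifies the open simplex with a Euclidean space, and
  \<open>simplex_sphere\<close> is this map followed by inverse stereographic projection, with denominators
  cleared. The second summand of \<open>Z\<close> vanishes on the simplex; it keeps the denominator positive at
  the points outside, which go to the base point.\<close>

definition simplex_sphere :: "(nat \<Rightarrow> 'a) \<Rightarrow> nat \<Rightarrow> ('a \<Rightarrow> real) \<Rightarrow> nat \<Rightarrow> real" where
  "simplex_sphere e n x =
     (let m = Min (x ` e ` {..<n});
          z = \<lambda>i. x (e i) - x (e 0);
          Z = (\<Sum>i<n. (z i)\<^sup>2) + (1 - (\<Sum>i<n. x (e i)))\<^sup>2
      in (\<lambda>i. if i = 0 then (Z - m\<^sup>2) / (Z + m\<^sup>2)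
              else if i < n then 2 * m * z i / (Z + m\<^sup>2) else 0))"

lemma sum_lessThan_split_0:
  fixes f :: "nat \<Rightarrow> 'b::comm_monoid_add"
  assumes "0 < n" shows "sum f {..<n} = f 0 + (\<Sum>i\<in>{1..<n}. f i)"
proof -
  have "{..<n} = insert 0 {1..<n}" using assms by auto
  then show ?thesis by simp
qed

text \<open>If all three terms vanished, the coordinates at the \<open>e i\<close> would agree, have
  minimum 0 and yet sum to 1.\<close>

lemma simplex_sphere_denominator_pos:
  fixes x :: "'a \<Rightarrow> real" and e :: "nat \<Rightarrow> 'a"
  assumes n: "0 < n"
  shows "0 < (\<Sum>i<n. (x (e i) - x (e 0))\<^sup>2) + (1 - (\<Sum>i<n. x (e i)))\<^sup>2 + (Min (x ` e ` {..<n}))\<^sup>2"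
    (is "0 < ?A + ?B + ?C")
proof (rule ccontr)
  assume "\<not> 0 < ?A + ?B + ?C"
  moreover have "0 \<le> ?A" "0 \<le> ?B" "0 \<le> ?C" by (simp_all add: sum_nonneg)
  ultimately have "?A = 0" "?B = 0" "?C = 0" by linarith+
  have eq: "x (e i) = x (e 0)" if "i < n" for i
  proof -
    have "\<forall>i\<in>{..<n}. (x (e i) - x (e 0))\<^sup>2 = 0"
      by (rule iffD1[OF sum_nonneg_eq_0_iff \<open>?A = 0\<close>]) auto
    from bspec[OF this, of i] that show ?thesis by simp
  qed
  have "x ` e ` {..<n} = (\<lambda>i. x (e i)) ` {..<n}" by (rule image_image)
  also have "\<dots> = (\<lambda>i. x (e 0)) ` {..<n}" by (intro image_cong) (auto intro: eq)
  also have "\<dots> = {x (e 0)}" using n by auto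
  finally have "x ` e ` {..<n} = {x (e 0)}" .
  then have "x (e 0) = 0" using \<open>?C = 0\<close> by simp
  then have "x (e i) = 0" if "i < n" for i using eq[OF that] by simp
  then have "(\<Sum>i<n. x (e i)) = 0" by simp
  then show False using \<open>?B = 0\<close> by simp
qed

lemma topspace_nsphere:
  "topspace (nsphere d) = {y. (\<Sum>i\<le>d. (y i)\<^sup>2) = 1 \<and> (\<forall>i>d. y i = 0)}"
  by (simp add: nsphere)

text \<open>The identity behind it is \<open>(Z - m^2)^2 + 4 m^2 Z = (Z + m^2)^2\<close>. As
  \<open>z 0 = 0\<close>, slot 0 is free for the height of the stereographic formula. The extra
  summand of \<open>Z\<close> does no harm: it is 0 unless \<open>m = 0\<close>, and then its
  product with \<open>m^2\<close> is 0.\<close>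

lemma simplex_sphere_in_nsphere:
  assumes n: "0 < n"
    and inside: "Min (x ` e ` {..<n}) \<noteq> 0 \<Longrightarrow> (\<Sum>i<n. x (e i)) = 1"
  shows "simplex_sphere e n x \<in> topspace (nsphere (n - 1))"
proof -
  define m where "m = Min (x ` e ` {..<n})"
  define z where "z i = x (e i) - x (e 0)" for i
  define B where "B = (1 - (\<Sum>i<n. x (e i)))\<^sup>2"
  define Z where "Z = (\<Sum>i<n. (z i)\<^sup>2) + B"
  have pos: "0 < Z + m\<^sup>2"
    using simplex_sphere_denominator_pos[OF n, of x e] unfolding Z_def z_def m_def B_def by simp
  have s: "simplex_sphere e n x = (\<lambda>i. if i = 0 then (Z - m\<^sup>2) / (Z + m\<^sup>2)
             else if i < n then 2 * m * z i / (Z + m\<^sup>2) else 0)"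
    unfolding simplex_sphere_def Let_def Z_def z_def m_def B_def by simp
  have "(\<Sum>i\<in>{1..<n}. (z i)\<^sup>2) = (\<Sum>i<n. (z i)\<^sup>2)"
    by (simp add: sum_lessThan_split_0[OF n] z_def)
  then have mz: "m\<^sup>2 * (\<Sum>i\<in>{1..<n}. (z i)\<^sup>2) = m\<^sup>2 * Z"
    using inside unfolding Z_def m_def[symmetric] B_def by auto
  have "{..n - 1} = {..<n}" using n by auto
  then have "(\<Sum>i\<le>n - 1. (simplex_sphere e n x i)\<^sup>2) =
      ((Z - m\<^sup>2) / (Z + m\<^sup>2))\<^sup>2 + (\<Sum>i\<in>{1..<n}. (2 * m * z i / (Z + m\<^sup>2))\<^sup>2)"
    by (simp add: sum_lessThan_split_0[OF n] s)
  also have "(\<Sum>i\<in>{1..<n}. (2 * m * z i / (Z + m\<^sup>2))\<^sup>2) =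
      4 * (m\<^sup>2 * (\<Sum>i\<in>{1..<n}. (z i)\<^sup>2)) / (Z + m\<^sup>2)\<^sup>2"
    by (simp add: power_divide power_mult_distrib sum_distrib_left sum_divide_distrib mult.assoc)
  also have "((Z - m\<^sup>2) / (Z + m\<^sup>2))\<^sup>2 + \<dots> = ((Z - m\<^sup>2)\<^sup>2 + 4 * (m\<^sup>2 * Z)) / (Z + m\<^sup>2)\<^sup>2"
    unfolding mz by (simp add: power_divide add_divide_distrib)
  also have "(Z - m\<^sup>2)\<^sup>2 + 4 * (m\<^sup>2 * Z) = (Z + m\<^sup>2)\<^sup>2"
    by (simp add: power2_sum power2_diff)
  finally show ?thesis using pos n by (auto simp: topspace_nsphere s)
qed

lemma simplex_sphere_eq_base:
  assumes n: "0 < n" and "Min (x ` e ` {..<n}) = 0"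
  shows "simplex_sphere e n x = nsphere_base"
  using simplex_sphere_denominator_pos[OF n, of x e] assms(2)
  by (auto simp: simplex_sphere_def Let_def nsphere_base_def fun_eq_iff)

text \<open>With \<open>y\<close> the image point, projection from the base point,
  \<open>y i / (1 - y 0)\<close>, undoes the formula: \<open>1 - y 0 = 2 m^2 / (Z + m^2)\<close>, so
  the denominators cancel and differences of scaled coordinates remain.\<close>

lemma simplex_sphere_stereographic:
  assumes n: "0 < n" and m: "Min (x ` e ` {..<n}) = m" "0 < m"
  shows "simplex_sphere e n x 0 < 1"
    and "i < n \<Longrightarrow> 0 < i \<Longrightarrow>
      simplex_sphere e n x i / (1 - simplex_sphere e n x 0) = x (e i) / m - x (e 0) / m"
proof -
  define z where "z i = x (e i) - x (e 0)" for i
  define Z where "Z = (\<Sum>i<n. (z i)\<^sup>2) + (1 - (\<Sum>i<n. x (e i)))\<^sup>2"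
  have pos: "0 < Z + m\<^sup>2"
    using simplex_sphere_denominator_pos[OF n, of x e] unfolding Z_def z_def m by simp
  have s: "simplex_sphere e n x = (\<lambda>i. if i = 0 then (Z - m\<^sup>2) / (Z + m\<^sup>2)
             else if i < n then 2 * m * z i / (Z + m\<^sup>2) else 0)"
    unfolding simplex_sphere_def Let_def m Z_def z_def by simp
  show "simplex_sphere e n x 0 < 1" using pos m(2) by (simp add: s)
  have 1: "1 - simplex_sphere e n x 0 = 2 * m\<^sup>2 / (Z + m\<^sup>2)"
    using pos by (simp add: s field_simps)
  show "simplex_sphere e n x i / (1 - simplex_sphere e n x 0) = x (e i) / m - x (e 0) / m"
    if "i < n" "0 < i"
    unfolding 1 using that pos m(2)
    by (simp add: s power2_eq_square z_def diff_divide_distrib[symmetric])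
qed

text \<open>By stereographic projection \<open>x / m\<close> and \<open>y / l\<close> have equal
  coordinate differences, so they differ by a constant \<open>k\<close>. Both have smallest
  coordinate 1, which forces \<open>k = 0\<close>; comparing the coordinate sums then gives
  \<open>m = l\<close>.\<close>

lemma simplex_sphere_inj:
  assumes n: "0 < n"
    and x: "0 < Min (x ` e ` {..<n})" "(\<Sum>i<n. x (e i)) = 1"
    and y: "0 < Min (y ` e ` {..<n})" "(\<Sum>i<n. y (e i)) = 1"
    and eq: "simplex_sphere e n x = simplex_sphere e n y" and i: "i < n"
  shows "x (e i) = y (e i)"
proof -
  define m where "m = Min (x ` e ` {..<n})"
  define l where "l = Min (y ` e ` {..<n})"
  have pos: "0 < m" "0 < l" using x y by (simp_all add: m_def l_def)
  define k where "k = x (e 0) / m - y (e 0) / l"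
  have k: "x (e i) / m = y (e i) / l + k" if "i < n" for i
    using simplex_sphere_stereographic(2)[OF n m_def[symmetric] pos(1) that]
      simplex_sphere_stereographic(2)[OF n l_def[symmetric] pos(2) that] eq
    by (cases "i = 0") (simp_all add: k_def)
  have ex: "\<exists>i<n. Min (w ` e ` {..<n}) = w (e i)" for w :: "'a \<Rightarrow> real"
  proof -
    have "Min (w ` e ` {..<n}) \<in> w ` e ` {..<n}" using n by (intro Min_in) auto
    then show ?thesis by auto
  qed
  have le: "Min (w ` e ` {..<n}) \<le> w (e i)" if "i < n" for w :: "'a \<Rightarrow> real" and i
    using that by (intro Min_le) auto
  obtain a where a: "a < n" "m = x (e a)" using ex[of x] m_def by auto
  obtain b where b: "b < n" "l = y (e b)" using ex[of y] l_def by auto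
  have "1 \<le> y (e a) / l" using le[OF a(1), of y] pos by (simp add: l_def)
  moreover have "x (e a) / m = 1" using a(2) pos by simp
  ultimately have "k \<le> 0" using k[OF a(1)] by linarith
  have "1 \<le> x (e b) / m" using le[OF b(1), of x] pos by (simp add: m_def)
  moreover have "y (e b) / l = 1" using b(2) pos by simp
  ultimately have "0 \<le> k" using k[OF b(1)] by linarith
  with \<open>k \<le> 0\<close> have k': "x (e i) / m = y (e i) / l" if "i < n" for i using k[OF that] by simp
  have "(\<Sum>i<n. x (e i) / m) = (\<Sum>i<n. y (e i) / l)" using k' by (intro sum.cong) auto
  then have "1 / m = 1 / l" using x(2) y(2) by (simp add: sum_divide_distrib[symmetric])
  then show ?thesis using k'[OF i] pos by simp
qed

lemma simplex_sphere_surj: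
  assumes n: "0 < n" and e: "inj_on e {..<n}"
    and y: "y \<in> topspace (nsphere (n - 1))" "y \<noteq> nsphere_base"
  obtains x where "\<And>v. 0 \<le> x v" "{v. x v \<noteq> 0} = e ` {..<n}" "sum x (e ` {..<n}) = 1"
    "0 < Min (x ` e ` {..<n})" "simplex_sphere e n x = y"
proof -
  have "{..n - 1} = {..<n}" using n by auto
  then have ysum: "(y 0)\<^sup>2 + (\<Sum>i\<in>{1..<n}. (y i)\<^sup>2) = 1" and y0: "\<And>i. n \<le> i \<Longrightarrow> y i = 0"
    using y(1) n by (auto simp: topspace_nsphere sum_lessThan_split_0)
  have sq: "(\<Sum>i\<in>{1..<n}. (y i)\<^sup>2) = (1 - y 0) * (1 + y 0)"
    using ysum by (simp add: power2_eq_square algebra_simps)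
  have "(y 0)\<^sup>2 \<le> 1" using ysum sum_nonneg[of "{1..<n}" "\<lambda>i. (y i)\<^sup>2"] by simp
  then have "y 0 \<le> 1" by (simp add: power2_le_iff_abs_le abs_square_le_1)
  moreover have "y 0 \<noteq> 1"
  proof
    assume 1: "y 0 = 1"
    then have "\<forall>i\<in>{1..<n}. (y i)\<^sup>2 = 0"
      using sq by (subst sum_nonneg_eq_0_iff[symmetric]) auto
    then have "y = nsphere_base" using 1 y0
      by (auto simp: nsphere_base_def fun_eq_iff not_less)
    then show False using y(2) by simp
  qed
  ultimately have y1: "0 < 1 - y 0" by simp
  \<comment> \<open>\<open>w\<close> is the stereographic projection of \<open>y\<close>, with 0 in
    slot 0. Shifting its smallest entry to 1 gives \<open>q\<close>, and dividing by the total
    \<open>S\<close> gives a point of the simplex with minimal coordinate \<open>1 / S\<close> and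
    the required scaled differences.\<close>
  define w where "w i = (if i = 0 then 0 else y i / (1 - y 0))" for i :: nat
  define q where "q i = w i - Min (w ` {..<n}) + 1" for i
  define S where "S = (\<Sum>i<n. q i)"
  have q1: "1 \<le> q i" if "i < n" for i
    using that Min_le[of "w ` {..<n}" "w i"] by (simp add: q_def)
  then have "(\<Sum>i<n. 1) \<le> S" unfolding S_def by (intro sum_mono) auto
  then have S: "0 < S" using n by simp
  define x where "x v = (if v \<in> e ` {..<n} then q (the_inv_into {..<n} e v) / S else 0)" for v
  have x: "x (e i) = q i / S" if "i < n" for i
    using that e by (simp add: x_def the_inv_into_f_f)
  have sum1: "(\<Sum>i<n. x (e i)) = 1"
    using x S by (simp add: sum_divide_distrib[symmetric] S_def[symmetric])
  have "Min (w ` {..<n}) \<in> w ` {..<n}" using n by (intro Min_in) auto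
  then obtain a where a: "a < n" "w a = Min (w ` {..<n})" by auto
  have Min: "Min (x ` e ` {..<n}) = 1 / S"
  proof (rule Min_eqI)
    show "1 / S \<le> r" if "r \<in> x ` e ` {..<n}" for r
      using that x q1 S by (auto simp: divide_right_mono)
    show "1 / S \<in> x ` e ` {..<n}"
      using a x[OF a(1)] by (auto simp: q_def intro!: image_eqI[of _ _ "e a"])
  qed simp
  have z: "x (e i) - x (e 0) = w i / S" if "i < n" for i
    using x[OF that] x[OF n] by (simp add: q_def w_def diff_divide_distrib[symmetric])
  have "(\<Sum>i<n. (w i)\<^sup>2) = (1 - y 0) * (1 + y 0) / (1 - y 0)\<^sup>2"
    by (simp add: sum_lessThan_split_0[OF n] w_def power_divide sum_divide_distrib[symmetric] sq[unfolded One_nat_def])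
  then have w2: "(\<Sum>i<n. (w i)\<^sup>2) = (1 + y 0) / (1 - y 0)"
    using y1 by (simp add: power2_eq_square)
  have Z: "(\<Sum>i<n. (x (e i) - x (e 0))\<^sup>2) = (1 + y 0) / (1 - y 0) / S\<^sup>2"
    using z w2 by (simp add: power_divide sum_divide_distrib[symmetric])
  have D: "(1 + y 0) / (1 - y 0) / S\<^sup>2 + (1 / S)\<^sup>2 = 2 / (1 - y 0) / S\<^sup>2"
  proof -
    have "(1 + y 0) / (1 - y 0) + 1 = 2 / (1 - y 0)" using y1 by (simp add: field_simps)
    then show ?thesis by (simp only: power_divide power_one add_divide_distrib[symmetric])
  qed
  have N: "(1 + y 0) / (1 - y 0) / S\<^sup>2 - (1 / S)\<^sup>2 = 2 * y 0 / (1 - y 0) / S\<^sup>2"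
  proof -
    have "(1 + y 0) / (1 - y 0) - 1 = 2 * y 0 / (1 - y 0)" using y1 by (simp add: field_simps)
    then show ?thesis by (simp only: power_divide power_one diff_divide_distrib[symmetric])
  qed
  have "simplex_sphere e n x i = y i" for i
  proof -
    consider "i = 0" | "0 < i" "i < n" | "n \<le> i" using n by linarith
    then show ?thesis
    proof cases
      case 1
      then show ?thesis
        unfolding simplex_sphere_def Let_def Min sum1 Z using N D y1 S by simp
    next
      case 2
      have "simplex_sphere e n x i = 2 * (1 / S) * (w i / S) / (2 / (1 - y 0) / S\<^sup>2)"
        unfolding simplex_sphere_def Let_def Min sum1 Z using 2 z D by simp
      also have "\<dots> = y i" using 2 y1 S by (simp add: w_def power2_eq_square)
      finally show ?thesis .
    next
      case 3
      then show ?thesis using n y0 by (simp add: simplex_sphere_def Let_def)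
    qed
  qed
  moreover have xpos: "0 < x (e i)" if "i < n" for i
    using x[OF that] q1[OF that] S by simp
  moreover have "{v. x v \<noteq> 0} = e ` {..<n}"
  proof (intro subset_antisym subsetI)
    show "v \<in> e ` {..<n}" if "v \<in> {v. x v \<noteq> 0}" for v
      using that by (auto simp: x_def split: if_splits)
    show "v \<in> {v. x v \<noteq> 0}" if "v \<in> e ` {..<n}" for v
      using that xpos by (auto simp: less_imp_neq[THEN not_sym])
  qed
  moreover have "0 \<le> x v" for v
  proof (cases "v \<in> e ` {..<n}")
    case True
    then show ?thesis using xpos by (auto intro: less_imp_le)
  next
    case False
    then show ?thesis by (simp add: x_def)
  qed
  moreover have "sum x (e ` {..<n}) = 1" using sum1 by (simp add: sum.reindex e)
  ultimately show thesis using that[of x] Min S by (simp add: fun_eq_iff)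
qed

lemma continuous_on_simplex_sphere:
  fixes e :: "nat \<Rightarrow> 'a" and S :: "('a \<Rightarrow> real) set"
  assumes n: "0 < n"
  shows "continuous_on S (simplex_sphere e n)"
proof (rule continuous_on_coordinatewise_then_product)
  fix i
  have M: "continuous_on S (\<lambda>x. Min (x ` e ` {..<n}))"
    using n by (intro continuous_on_Min_image continuous_on_coordinate) auto
  let ?Z = "\<lambda>x. (\<Sum>i<n. (x (e i) - x (e 0))\<^sup>2) + (1 - (\<Sum>i<n. x (e i)))\<^sup>2 :: real"
  have Z: "continuous_on S ?Z"
    by (intro continuous_on_add continuous_on_sum continuous_on_power continuous_on_diff
        continuous_on_const continuous_on_coordinate)
  have D: "\<forall>x\<in>S. ?Z x + (Min (x ` e ` {..<n}))\<^sup>2 \<noteq> 0"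
    using simplex_sphere_denominator_pos[OF n] by (metis less_irrefl)
  consider "i = 0" | "0 < i" "i < n" | "n \<le> i" "i \<noteq> 0" using n by linarith
  then show "continuous_on S (\<lambda>x. simplex_sphere e n x i)"
  proof cases
    case 1
    have "continuous_on S (\<lambda>x. (?Z x - (Min (x ` e ` {..<n}))\<^sup>2) / (?Z x + (Min (x ` e ` {..<n}))\<^sup>2))"
      by (intro continuous_on_divide continuous_on_add continuous_on_diff continuous_on_power Z M D)
    then show ?thesis using 1 by (simp add: simplex_sphere_def Let_def)
  next
    case 2
    have "continuous_on S (\<lambda>x. 2 * Min (x ` e ` {..<n}) * (x (e i) - x (e 0)) /
        (?Z x + (Min (x ` e ` {..<n}))\<^sup>2))"
      by (intro continuous_on_divide continuous_on_add continuous_on_mult continuous_on_diff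
          continuous_on_power continuous_on_const continuous_on_coordinate Z M D)
    then show ?thesis using 2 by (simp add: simplex_sphere_def Let_def)
  next
    case 3
    then show ?thesis by (simp add: simplex_sphere_def Let_def)
  qed
qed

text \<open>The retractions \<open>\<pi> i\<close> onto the summands are continuous and together
  inject the wedge into a product of Hausdorff spaces.\<close>

lemma Hausdorff_space_wedge_topology:
  assumes H: "\<And>i. i \<in> I \<Longrightarrow> Hausdorff_space (X i)" and p: "\<And>i. i \<in> I \<Longrightarrow> p i \<in> topspace (X i)"
  shows "Hausdorff_space (wedge_topology X p I)"
proof -
  define \<pi> where "\<pi> i y = (case y of None \<Rightarrow> p i | Some (j, x) \<Rightarrow> if j = i then x else p i)" for i y
  have \<pi>_inj: "\<pi> i (wedge_inj p (j, x)) = (if j = i then x else p i)" for i j x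
    by (auto simp: \<pi>_def wedge_inj_def)
  have cont: "continuous_map (wedge_topology X p I) (X i) (\<pi> i)" if i: "i \<in> I" for i
    unfolding continuous_map_def openin_wedge_topology
  proof (intro conjI ballI allI impI)
    show "\<pi> i \<in> topspace (wedge_topology X p I) \<rightarrow> topspace (X i)"
      using p[OF i] by (auto simp: topspace_wedge_topology \<pi>_inj) (simp add: \<pi>_def)
    fix U assume U: "openin (X i) U"
    show "{y \<in> topspace (wedge_topology X p I). \<pi> i y \<in> U}
        \<subseteq> insert None (wedge_inj p ` (SIGMA i:I. topspace (X i)))"
      by (auto simp: topspace_wedge_topology)
    fix j assume j: "j \<in> I"
    have eq: "{x \<in> topspace (X j). wedge_inj p (j, x) \<in> {y \<in> topspace (wedge_topology X p I). \<pi> i y \<in> U}} =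
        {x \<in> topspace (X j). (if j = i then x else p i) \<in> U}"
      using j by (auto simp: topspace_wedge_topology \<pi>_inj split: if_splits)
    show "openin (X j) {x \<in> topspace (X j). wedge_inj p (j, x) \<in> {y \<in> topspace (wedge_topology X p I). \<pi> i y \<in> U}}"
      unfolding eq
    proof (cases "j = i")
      case True
      then have "{x \<in> topspace (X j). (if j = i then x else p i) \<in> U} = U"
        using openin_subset[OF U] by auto
      then show "openin (X j) {x \<in> topspace (X j). (if j = i then x else p i) \<in> U}" using U True by simp
    next
      case False
      then show "openin (X j) {x \<in> topspace (X j). (if j = i then x else p i) \<in> U}"
        by (cases "p i \<in> U") auto
    qed
  qed
  have "Hausdorff_space (product_topology X I)"
    using H by (simp add: Hausdorff_space_product_topology)
  moreover have "continuous_map (wedge_topology X p I) (product_topology X I) (\<lambda>y. restrict (\<lambda>i. \<pi> i y) I)"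
    using cont by (auto simp: continuous_map_componentwise)
  moreover have "inj_on (\<lambda>y. restrict (\<lambda>i. \<pi> i y) I) (topspace (wedge_topology X p I))"
  proof (rule inj_onI)
    fix y y' assume y: "y \<in> topspace (wedge_topology X p I)" "y' \<in> topspace (wedge_topology X p I)"
      and eq: "restrict (\<lambda>i. \<pi> i y) I = restrict (\<lambda>i. \<pi> i y') I"
    have eq': "\<pi> i y = \<pi> i y'" if "i \<in> I" for i
      using fun_cong[OF eq, of i] that by simp
    have cs: "y = None \<or> (\<exists>i x. y = Some (i, x) \<and> i \<in> I \<and> x \<noteq> p i)"
      if mem: "y \<in> topspace (wedge_topology X p I)" for y
    proof -
      consider "y = None" | i x where "i \<in> I" "y = wedge_inj p (i, x)"
        using mem unfolding topspace_wedge_topology by blast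
      then show ?thesis by cases (simp_all add: wedge_inj_def)
    qed
    show "y = y'"
      using cs[OF y(1)] cs[OF y(2)]
    proof (elim disjE exE conjE)
      fix i x j x' assume "y = Some (i, x)" "i \<in> I" "x \<noteq> p i" "y' = Some (j, x')" "j \<in> I" "x' \<noteq> p j"
      then show ?thesis using eq'[of i] by (auto simp: \<pi>_def split: if_splits)
    next
      fix i x assume "y = None" "y' = Some (i, x)" "i \<in> I" "x \<noteq> p i"
      then show ?thesis using eq'[of i] by (auto simp: \<pi>_def)
    next
      fix i x assume "y' = None" "y = Some (i, x)" "i \<in> I" "x \<noteq> p i"
      then show ?thesis using eq'[of i] by (auto simp: \<pi>_def)
    qed simp
  qed
  ultimately show ?thesis by (rule Hausdorff_space_injective_preimage)
qed


section \<open>Simplices attached to a cone\<close>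

text \<open>Having \<open>{}\<close> in \<open>C\<close> makes \<open>{c}\<close> a vertex of the
  cone; positive \<open>n\<close> makes the facets nonempty, so that their coordinates have a
  minimum.\<close>

locale facets_on_cone =
  fixes C F :: "'a set set" and c :: 'a and n :: nat
  assumes C: "simplicial C" "{} \<in> C" and F: "finite F" and n: "0 < n"
    and card_F: "\<And>\<tau>. \<tau> \<in> F \<Longrightarrow> card \<tau> = n"
    and boundary_F: "\<And>\<tau> \<rho>. \<tau> \<in> F \<Longrightarrow> \<rho> \<subset> \<tau> \<Longrightarrow> \<rho> \<in> C"
    and F_C: "\<And>\<tau>. \<tau> \<in> F \<Longrightarrow> \<tau> \<notin> C"
    and c_C: "\<And>\<sigma>. \<sigma> \<in> C \<Longrightarrow> c \<notin> \<sigma>" and c_F: "\<And>\<tau>. \<tau> \<in> F \<Longrightarrow> c \<notin> \<tau>"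
begin

definition K where "K = C \<union> insert c ` C \<union> F"

text \<open>On \<open>geo K\<close> it is positive exactly on the open simplex of the facet
  \<open>\<tau>\<close>. Hence at most one \<open>M \<tau>\<close> is nonzero at any point.\<close>

definition M :: "'a set \<Rightarrow> ('a \<Rightarrow> real) \<Rightarrow> real" where "M \<tau> x = Min (x ` \<tau>)"

lemma finite_facet: "\<tau> \<in> F \<Longrightarrow> finite \<tau>" and facet_nonempty: "\<tau> \<in> F \<Longrightarrow> \<tau> \<noteq> {}"
  using card_F n card_gt_0_iff[of \<tau>] by auto

lemma simplicial_K: "simplicial K"
  unfolding simplicial_def
proof (intro conjI ballI allI impI)
  have cone: "simplicial (C \<union> insert c ` C)" by (rule simplicial_cone[OF C(1) C(1) subset_refl])
  show "finite K" unfolding K_def using simplicialD(1)[OF cone] F by simp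
  fix \<sigma> assume \<sigma>: "\<sigma> \<in> K"
  then show "finite \<sigma>" using simplicialD(2)[OF cone] finite_facet unfolding K_def by blast
  fix \<rho> assume \<rho>: "\<rho> \<subseteq> \<sigma>"
  show "\<rho> \<in> K"
  proof (cases "\<sigma> \<in> F")
    case True
    then show ?thesis using \<rho> boundary_F[of \<sigma> \<rho>] unfolding K_def by (cases "\<rho> = \<sigma>") auto
  next
    case False
    then show ?thesis using \<rho> \<sigma> simplicialD(3)[OF cone, of \<sigma> \<rho>] unfolding K_def by auto
  qed
qed

lemma M_le: "\<tau> \<in> F \<Longrightarrow> u \<in> \<tau> \<Longrightarrow> M \<tau> x \<le> x u"
  unfolding M_def using finite_facet by simp

lemma M_attained:
  assumes "\<tau> \<in> F" obtains u where "u \<in> \<tau>" "M \<tau> x = x u"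
proof -
  have "M \<tau> x \<in> x ` \<tau>"
    unfolding M_def using finite_facet facet_nonempty assms by (intro Min_in) auto
  then show thesis using that by blast
qed

lemma M_nonneg: "x \<in> geo K \<Longrightarrow> \<tau> \<in> F \<Longrightarrow> 0 \<le> M \<tau> x"
  using M_attained[of \<tau> x] geoD(1)[of x K] by metis

text \<open>A coface in \<open>C\<close> would put \<open>\<tau>\<close> into \<open>C\<close>, and
  so would one in the cone, since \<open>c\<close> is not a vertex of \<open>\<tau>\<close>; a
  coface in \<open>F\<close> has equally many vertices.\<close>

lemma facet_maximal:
  assumes "\<tau> \<in> F" "\<sigma> \<in> K" "\<tau> \<subseteq> \<sigma>" shows "\<sigma> = \<tau>"
proof -
  have notC: "\<not> \<tau> \<subseteq> \<rho>" if "\<rho> \<in> C" for \<rho>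
    using simplicialD(3)[OF C(1) that] F_C[OF assms(1)] by blast
  moreover have "\<sigma> \<noteq> insert c \<rho>" if "\<rho> \<in> C" for \<rho>
    using notC[OF that] assms(3) c_F[OF assms(1)] by blast
  ultimately have "\<sigma> \<in> F" using assms(2,3) unfolding K_def by blast
  then show ?thesis
    using card_seteq[OF finite_facet assms(3)] card_F assms(1) by simp
qed

lemma support_eq_facet:
  assumes "x \<in> geo K" "\<tau> \<in> F" "M \<tau> x \<noteq> 0"
  shows "{u. x u \<noteq> 0} = \<tau>"
proof -
  have "0 < M \<tau> x" using M_nonneg[OF assms(1,2)] assms(3) by simp
  then have "\<tau> \<subseteq> {u. x u \<noteq> 0}" using M_le[OF assms(2), of _ x] by force
  then show ?thesis by (rule facet_maximal[OF assms(2) geoD(2)[OF assms(1)]])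
qed

lemma M_pos_if_support:
  assumes "x \<in> geo K" "\<tau> \<in> F" "{u. x u \<noteq> 0} = \<tau>"
  shows "0 < M \<tau> x"
proof -
  obtain u where "u \<in> \<tau>" "M \<tau> x = x u" by (rule M_attained[OF assms(2)])
  then show ?thesis using assms(3) geoD(1)[OF assms(1), of u] by auto
qed

lemma geo_K_cases:
  assumes "x \<in> geo K"
  obtains (cone) "\<And>\<tau>. \<tau> \<in> F \<Longrightarrow> M \<tau> x = 0" "{u. x u \<noteq> 0} \<in> C \<union> insert c ` C"
  | (facet) \<tau> where "\<tau> \<in> F" "{u. x u \<noteq> 0} = \<tau>" "0 < M \<tau> x" "sum x \<tau> = 1"
      "\<And>\<tau>'. \<tau>' \<in> F \<Longrightarrow> M \<tau>' x = (if \<tau>' = \<tau> then M \<tau> x else 0)"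
proof (cases "{u. x u \<noteq> 0} \<in> F")
  case True
  show thesis
  proof (rule facet[OF True refl])
    show "0 < M {u. x u \<noteq> 0} x" by (rule M_pos_if_support[OF assms True refl])
    show "sum x {u. x u \<noteq> 0} = 1" using assms by (simp add: geo_def)
    show "M \<tau>' x = (if \<tau>' = {u. x u \<noteq> 0} then M {u. x u \<noteq> 0} x else 0)" if "\<tau>' \<in> F" for \<tau>'
      using support_eq_facet[OF assms that] by auto
  qed
next
  case False
  show thesis
  proof (rule cone)
    show "M \<tau> x = 0" if "\<tau> \<in> F" for \<tau>
      using support_eq_facet[OF assms that] that False by auto
    show "{u. x u \<noteq> 0} \<in> C \<union> insert c ` C"
      using geoD(2)[OF assms] False unfolding K_def by blast
  qed
qed

text \<open>The unnormalised homotopy \<open>V\<close> contracts the cone to its apex. On a facet, the minimum \<open>m\<close> of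
  the coordinates is the distance to the boundary: points with \<open>m < t * \<kappa>\<close> move into the cone over
  the boundary, the others keep a positive multiple of the barycenter and stay in the facet.\<close>

definition \<kappa> :: real where "\<kappa> = 1 / (2 * real n)"

definition SM :: "('a \<Rightarrow> real) \<Rightarrow> real" where "SM x = (\<Sum>\<tau>\<in>F. M \<tau> x)"

text \<open>Inside a facet, \<open>x\<close> is split into \<open>x - m\<close> and the mass
  \<open>m\<close> on each vertex. The factor \<open>1 - t + t * SM x\<close> of the first part ends
  at \<open>SM x\<close>. This is 0 on the cone, where only the apex remains at time 1, but positive
  inside a facet, where it keeps \<open>V\<close> from vanishing when
  \<open>m = t * \<kappa>\<close> and both other parts are 0. Summing over \<open>F\<close> gives
  one continuous formula for all cases.\<close>

definition V :: "real \<Rightarrow> ('a \<Rightarrow> real) \<Rightarrow> 'a \<Rightarrow> real" where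
  "V t x u = (1 - t + t * SM x) * (x u - (\<Sum>\<tau>\<in>F. if u \<in> \<tau> then M \<tau> x else 0)) +
     (\<Sum>\<tau>\<in>F. if u \<in> \<tau> then max 0 (M \<tau> x - t * \<kappa>) else 0) +
     (if u = c then max 0 (t * \<kappa> - SM x) else 0)"

definition H :: "real \<times> ('a \<Rightarrow> real) \<Rightarrow> 'a \<Rightarrow> real" where
  "H p u = V (fst p) (snd p) u / sum (V (fst p) (snd p)) (\<Union>K)"

lemma \<kappa>_pos: "0 < \<kappa>" using n by (simp add: \<kappa>_def)

lemma V_cone:
  assumes "\<And>\<tau>. \<tau> \<in> F \<Longrightarrow> M \<tau> x = 0" "0 \<le> t"
  shows "V t x u = (1 - t) * x u + (if u = c then t * \<kappa> else 0)"
proof -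
  have "SM x = 0" using assms(1) by (simp add: SM_def)
  moreover have "(\<Sum>\<tau>\<in>F. if u \<in> \<tau> then M \<tau> x else 0) = 0"
    using assms(1) by (intro sum.neutral) auto
  moreover have "(\<Sum>\<tau>\<in>F. if u \<in> \<tau> then max 0 (M \<tau> x - t * \<kappa>) else 0) = 0"
    using assms \<kappa>_pos by (intro sum.neutral) auto
  ultimately show ?thesis using assms(2) \<kappa>_pos unfolding V_def by simp
qed

lemma V_facet:
  assumes \<tau>: "\<tau> \<in> F" "{u. x u \<noteq> 0} = \<tau>" "m = M \<tau> x"
    and M: "\<And>\<tau>'. \<tau>' \<in> F \<Longrightarrow> M \<tau>' x = (if \<tau>' = \<tau> then M \<tau> x else 0)" and t: "0 \<le> t"
  shows "V t x u = (if u \<in> \<tau> then (1 - t + t * m) * (x u - m) + max 0 (m - t * \<kappa>)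
    else if u = c then max 0 (t * \<kappa> - m) else 0)"
proof -
  have "SM x = (\<Sum>\<tau>'\<in>F. if \<tau>' = \<tau> then m else 0)"
    unfolding SM_def \<tau>(3) by (intro sum.cong refl M)
  then have "SM x = m" using \<tau>(1) F by simp
  moreover have "(\<Sum>\<tau>'\<in>F. if u \<in> \<tau>' then M \<tau>' x else 0) =
      (\<Sum>\<tau>'\<in>F. if \<tau>' = \<tau> then (if u \<in> \<tau> then m else 0) else 0)"
    using M \<tau>(3) by (intro sum.cong refl) auto
  then have "(\<Sum>\<tau>'\<in>F. if u \<in> \<tau>' then M \<tau>' x else 0) = (if u \<in> \<tau> then m else 0)"
    using \<tau>(1) F by simp
  moreover have "(\<Sum>\<tau>'\<in>F. if u \<in> \<tau>' then max 0 (M \<tau>' x - t * \<kappa>) else 0) =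
      (\<Sum>\<tau>'\<in>F. if \<tau>' = \<tau> then (if u \<in> \<tau> then max 0 (m - t * \<kappa>) else 0) else 0)"
    using M \<tau>(3) t \<kappa>_pos by (intro sum.cong refl) auto
  then have "(\<Sum>\<tau>'\<in>F. if u \<in> \<tau>' then max 0 (M \<tau>' x - t * \<kappa>) else 0) =
      (if u \<in> \<tau> then max 0 (m - t * \<kappa>) else 0)"
    using \<tau>(1) F by simp
  moreover have "x u = 0" if "u \<notin> \<tau>" using that \<tau>(2) by auto
  moreover have "u \<noteq> c" if "u \<in> \<tau>" using that c_F[OF \<tau>(1)] by auto
  ultimately show ?thesis unfolding V_def by auto
qed

lemma V_properties:
  assumes x: "x \<in> geo K" and t: "0 \<le> t" "t \<le> 1"
  shows "0 \<le> V t x u" "{u. V t x u \<noteq> 0} \<in> K" "\<exists>u. 0 < V t x u"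
proof -
  have "(\<forall>u. 0 \<le> V t x u) \<and> {u. V t x u \<noteq> 0} \<in> K \<and> (\<exists>u. 0 < V t x u)"
    using x
  proof (cases rule: geo_K_cases)
    case cone
    have V: "V t x u = (1 - t) * x u + (if u = c then t * \<kappa> else 0)" for u
      by (rule V_cone[OF _ t(1)]) (rule cone(1))
    have nonneg: "0 \<le> V t x u" for u
      unfolding V using t geoD(1)[OF x] \<kappa>_pos by simp
    have "{u. x u \<noteq> 0} \<union> {c} \<in> K"
      using cone(2) unfolding K_def by auto
    then have "{u. V t x u \<noteq> 0} \<in> K"
      by (rule simplicialD(3)[OF simplicial_K]) (auto simp: V)
    moreover have "\<exists>u. 0 < V t x u"
    proof (cases "t = 0")
      case True
      have "(\<Sum>u | x u \<noteq> 0. x u) \<noteq> 0" using x by (simp add: geo_def)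
      then obtain u where "x u \<noteq> 0" by (rule sum.not_neutral_contains_not_neutral)
      then have "0 < x u" using geoD(1)[OF x, of u] by simp
      then have "0 < V t x u" using V[of u] True by (simp split: if_splits)
      then show ?thesis by blast
    next
      case False
      then have "0 < V t x c"
        unfolding V using t \<kappa>_pos geoD(1)[OF x, of c] by (simp add: add_nonneg_pos)
      then show ?thesis by blast
    qed
    ultimately show ?thesis using nonneg by blast
  next
    case (facet \<tau>)
    define m where "m = M \<tau> x"
    have m: "0 < m" using facet(3) by (simp add: m_def)
    have V: "V t x u = (if u \<in> \<tau> then (1 - t + t * m) * (x u - m) + max 0 (m - t * \<kappa>)
      else if u = c then max 0 (t * \<kappa> - m) else 0)" for u
      by (rule V_facet[OF facet(1,2) m_def _ t(1)]) (rule facet(5))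
    have coef: "0 \<le> 1 - t + t * m" using t m by simp
    have le: "m \<le> x u" if "u \<in> \<tau>" for u using M_le[OF facet(1) that] by (simp add: m_def)
    have nonneg: "0 \<le> V t x u" for u
      unfolding V using le[of u] coef by (auto intro!: add_nonneg_nonneg mult_nonneg_nonneg)
    have "{u. V t x u \<noteq> 0} \<in> K"
    proof (cases "m < t * \<kappa>")
      case True
      \<comment> \<open>A vertex with minimal coordinate has lost all its mass, so the support lies
        in the cone over the proper face \<open>\<tau> - {w}\<close>.\<close>
      obtain w where w: "w \<in> \<tau>" "M \<tau> x = x w" by (rule M_attained[OF facet(1)])
      then have "V t x w = 0" using True by (simp add: V m_def[symmetric])
      moreover have "{u. V t x u \<noteq> 0} \<subseteq> insert c \<tau>" by (auto simp: V)
      ultimately have "{u. V t x u \<noteq> 0} \<subseteq> insert c (\<tau> - {w})" by auto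
      moreover have "insert c (\<tau> - {w}) \<in> K"
        using boundary_F[OF facet(1), of "\<tau> - {w}"] w(1) unfolding K_def by auto
      ultimately show ?thesis by (rule simplicialD(3)[OF simplicial_K, rotated])
    next
      case False
      then have "{u. V t x u \<noteq> 0} \<subseteq> \<tau>" by (auto simp: V)
      moreover have "\<tau> \<in> K" using facet(1) unfolding K_def by blast
      ultimately show ?thesis by (rule simplicialD(3)[OF simplicial_K, rotated])
    qed
    moreover have "\<exists>u. 0 < V t x u"
    proof -
      obtain w where w: "w \<in> \<tau>" using facet_nonempty[OF facet(1)] by auto
      consider "m < t * \<kappa>" | "t * \<kappa> < m" | "m = t * \<kappa>" by linarith
      then show ?thesis
      proof cases
        case 1
        then have "0 < V t x c" using c_F[OF facet(1)] by (simp add: V)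
        then show ?thesis by blast
      next
        case 2
        then have "0 < V t x w"
          using w le[OF w] coef by (auto simp: V intro!: add_nonneg_pos mult_nonneg_nonneg)
        then show ?thesis by blast
      next
        case 3
        have "0 < t" using 3 m t by (cases "t = 0") auto
        \<comment> \<open>Here the value \<open>1 / (2 n)\<close> of \<open>\<kappa>\<close>
          matters: if all coordinates were at most \<open>m \<le> \<kappa>\<close>, they would sum
          to at most 1/2 instead of 1.\<close>
        have "\<exists>u\<in>\<tau>. m < x u"
        proof (rule ccontr)
          assume "\<not> (\<exists>u\<in>\<tau>. m < x u)"
          then have "sum x \<tau> \<le> (\<Sum>u\<in>\<tau>. m)" by (intro sum_mono) (auto simp: not_less)
          also have "\<dots> = real n * m" using card_F[OF facet(1)] by simp
          also have "\<dots> \<le> real n * (1 * \<kappa>)"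
            unfolding 3 using t \<kappa>_pos by (intro mult_left_mono mult_right_mono) auto
          also have "\<dots> = 1 / 2" using n by (simp add: \<kappa>_def)
          finally show False using facet(4) by simp
        qed
        then obtain u where u: "u \<in> \<tau>" "m < x u" by blast
        have "0 < 1 - t + t * m" using t m \<open>0 < t\<close> by (simp add: add_nonneg_pos)
        then have "0 < V t x u" using u 3 by (simp add: V)
        then show ?thesis by blast
      qed
    qed
    ultimately show ?thesis using nonneg by blast
  qed
  then show "0 \<le> V t x u" "{u. V t x u \<noteq> 0} \<in> K" "\<exists>u. 0 < V t x u" by blast+
qed

lemma finite_vertices: "finite (\<Union>K)"
  using simplicialD(1,2)[OF simplicial_K] by (intro finite_Union)

lemma sum_V_pos:
  assumes x: "x \<in> geo K" and t: "0 \<le> t" "t \<le> 1"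
  shows "0 < sum (V t x) (\<Union>K)"
proof -
  obtain u where u: "0 < V t x u" using V_properties(3)[OF assms] by blast
  then have "u \<in> \<Union>K" using V_properties(2)[OF assms] by (intro UnionI[of "{u. V t x u \<noteq> 0}"]) auto
  then show ?thesis
    using u V_properties(1)[OF assms] finite_vertices by (intro sum_pos2[of _ u]) auto
qed

lemma H_in:
  assumes x: "x \<in> geo K" and t: "0 \<le> t" "t \<le> 1"
  shows "H (t, x) \<in> geo K"
proof -
  note pos = sum_V_pos[OF assms]
  have supp: "{u. H (t, x) u \<noteq> 0} = {u. V t x u \<noteq> 0}" using pos by (auto simp: H_def)
  show ?thesis
  proof (rule geoI[where V = "\<Union>K"])
    show "0 \<le> H (t, x) u" for u using pos V_properties(1)[OF assms] by (simp add: H_def)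
    show "{u. H (t, x) u \<noteq> 0} \<in> K" unfolding supp by (rule V_properties(2)[OF assms])
    then show "{u. H (t, x) u \<noteq> 0} \<subseteq> \<Union>K" by blast
    show "sum (H (t, x)) (\<Union>K) = 1"
      using pos by (simp add: H_def sum_divide_distrib[symmetric])
  qed (rule finite_vertices)
qed

lemma H_0:
  assumes x: "x \<in> geo K"
  shows "H (0, x) = x"
proof -
  have V0: "V 0 x = x"
    using x
  proof (cases rule: geo_K_cases)
    case cone
    then show ?thesis using V_cone[OF cone(1), of 0] by auto
  next
    case (facet \<tau>)
    have "x u = 0" if "u \<notin> \<tau>" for u using facet(2) that by auto
    then show ?thesis using V_facet[OF facet(1,2) refl facet(5), of 0] facet(3) by auto
  qed
  have "sum x (\<Union>K) = 1"
    using geoD(2)[OF x] by (intro geo_sum[OF x finite_vertices]) blast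
  then show ?thesis using V0 by (simp add: H_def fun_eq_iff)
qed

text \<open>A vertex \<open>u\<close> of \<open>\<tau>\<close> with coordinate 0 keeps it, since off
  the apex the homotopy only rescales such a point. So the set to be collapsed stays within itself
  at all times.\<close>

lemma H_cone:
  assumes x: "x \<in> geo K" and t: "0 \<le> t" "t \<le> 1"
    and M: "\<And>\<tau>. \<tau> \<in> F \<Longrightarrow> M \<tau> x = 0" and \<tau>: "\<tau> \<in> F"
  shows "M \<tau> (H (t, x)) = 0"
proof -
  obtain u where u: "u \<in> \<tau>" "M \<tau> x = x u" by (rule M_attained[OF \<tau>])
  then have "V t x u = 0" using V_cone[OF M t(1), of u] M[OF \<tau>] c_F[OF \<tau>] by auto
  then have "H (t, x) u = 0" by (simp add: H_def)
  then show ?thesis using M_le[OF \<tau> u(1), of "H (t, x)"] M_nonneg[OF H_in[OF x t] \<tau>] by simp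
qed

lemma H_1_cone:
  assumes "x \<in> geo K" and M: "\<And>\<tau>. \<tau> \<in> F \<Longrightarrow> M \<tau> x = 0"
  shows "H (1, x) = (\<lambda>u. if u = c then 1 else 0)"
proof -
  have V: "V 1 x = (\<lambda>u. if u = c then \<kappa> else 0)" using V_cone[OF M, of 1] by auto
  have "c \<in> \<Union>K" using C(2) unfolding K_def by blast
  then have "sum (V 1 x) (\<Union>K) = \<kappa>" using finite_vertices by (simp add: V)
  then show ?thesis using \<kappa>_pos by (simp add: H_def V fun_eq_iff)
qed

lemma continuous_on_H: "continuous_on ({0..1} \<times> geo K) H"
proof -
  have M: "continuous_on T (\<lambda>p. M \<tau> (snd p))" if "\<tau> \<in> F" for T :: "(real \<times> ('a \<Rightarrow> real)) set" and \<tau>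
    unfolding M_def using finite_facet[OF that] facet_nonempty[OF that]
    by (intro continuous_on_Min_image continuous_on_snd_coordinate)
  have SM: "continuous_on T (\<lambda>p. SM (snd p))" for T :: "(real \<times> ('a \<Rightarrow> real)) set"
    unfolding SM_def by (intro continuous_on_sum M)
  have V: "continuous_on T (\<lambda>p. V (fst p) (snd p) u)" for T :: "(real \<times> ('a \<Rightarrow> real)) set" and u
  proof -
    have 1: "continuous_on T (\<lambda>p. if u \<in> \<tau> then M \<tau> (snd p) else 0)" if "\<tau> \<in> F" for \<tau>
      using M[OF that, of T] by (cases "u \<in> \<tau>") simp_all
    have 2: "continuous_on T (\<lambda>p. if u \<in> \<tau> then max 0 (M \<tau> (snd p) - fst p * \<kappa>) else 0)"
      if "\<tau> \<in> F" for \<tau>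
    proof (cases "u \<in> \<tau>")
      case True
      have "continuous_on T (\<lambda>p. max 0 (M \<tau> (snd p) - fst p * \<kappa>))"
        by (intro continuous_on_max continuous_on_const continuous_on_diff continuous_on_mult
            continuous_on_fst continuous_on_id M[OF that])
      then show ?thesis using True by simp
    qed simp
    have 3: "continuous_on T (\<lambda>p. if u = c then max 0 (fst p * \<kappa> - SM (snd p)) else 0)"
    proof (cases "u = c")
      case True
      have "continuous_on T (\<lambda>p. max 0 (fst p * \<kappa> - SM (snd p)))"
        by (intro continuous_on_max continuous_on_const continuous_on_diff continuous_on_mult
            continuous_on_fst continuous_on_id SM)
      then show ?thesis using True by simp
    qed simp
    show ?thesis
      unfolding V_def
      by (intro continuous_on_add continuous_on_mult continuous_on_diff continuous_on_const
          continuous_on_fst continuous_on_id SM continuous_on_sum 1 2 3 continuous_on_snd_coordinate)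
  qed
  have "\<forall>p\<in>{0..1} \<times> geo K. sum (V (fst p) (snd p)) (\<Union>K) \<noteq> 0"
  proof
    fix p :: "real \<times> ('a \<Rightarrow> real)" assume "p \<in> {0..1} \<times> geo K"
    then have "0 < sum (V (fst p) (snd p)) (\<Union>K)" by (intro sum_V_pos) auto
    then show "sum (V (fst p) (snd p)) (\<Union>K) \<noteq> 0" by simp
  qed
  then show ?thesis
    unfolding H_def
    by (intro continuous_on_coordinatewise_then_product continuous_on_divide V continuous_on_sum)
qed

lemma sphere_map:
  assumes e: "bij_betw e {..<n} \<tau>" and \<tau>: "\<tau> \<in> F"
  shows "continuous_map (top_of_set (geo K)) (nsphere (n - 1)) (simplex_sphere e n)"
    and "x \<in> geo K \<Longrightarrow> M \<tau> x = 0 \<Longrightarrow> simplex_sphere e n x = nsphere_base"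
    and "x \<in> geo K \<Longrightarrow> M \<tau> x \<noteq> 0 \<Longrightarrow> simplex_sphere e n x \<noteq> nsphere_base"
    and "x \<in> geo K \<Longrightarrow> y \<in> geo K \<Longrightarrow> M \<tau> x \<noteq> 0 \<Longrightarrow> M \<tau> y \<noteq> 0 \<Longrightarrow>
      simplex_sphere e n x = simplex_sphere e n y \<Longrightarrow> x = y"
    and "z \<in> topspace (nsphere (n - 1)) \<Longrightarrow> z \<noteq> nsphere_base \<Longrightarrow>
      \<exists>x\<in>geo K. M \<tau> x \<noteq> 0 \<and> simplex_sphere e n x = z"
proof -
  have im: "e ` {..<n} = \<tau>" and inj: "inj_on e {..<n}" using e by (auto simp: bij_betw_def)
  have M: "Min (x ` e ` {..<n}) = M \<tau> x" for x by (simp add: im M_def)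
  have sum1: "(\<Sum>i<n. x (e i)) = 1" if "x \<in> geo K" "M \<tau> x \<noteq> 0" for x
  proof -
    have "(\<Sum>i<n. x (e i)) = sum x \<tau>" using sum.reindex[OF inj, of x] im by simp
    also have "\<dots> = 1"
      using support_eq_facet[OF that(1) \<tau> that(2)] finite_facet[OF \<tau>] by (intro geo_sum[OF that(1)]) auto
    finally show ?thesis .
  qed
  have in_sphere: "simplex_sphere e n x \<in> topspace (nsphere (n - 1))" if "x \<in> geo K" for x
    using sum1[OF that] M by (intro simplex_sphere_in_nsphere n) simp
  have ns: "nsphere (n - 1) = top_of_set (topspace (nsphere (n - 1)))"
    by (simp add: nsphere euclidean_product_topology)
  show "continuous_map (top_of_set (geo K)) (nsphere (n - 1)) (simplex_sphere e n)"
    by (subst ns) (use continuous_on_simplex_sphere[OF n] in_sphere in auto)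
  show "simplex_sphere e n x = nsphere_base" if "x \<in> geo K" "M \<tau> x = 0"
    using that M by (intro simplex_sphere_eq_base n) simp
  show "simplex_sphere e n x \<noteq> nsphere_base" if x: "x \<in> geo K" "M \<tau> x \<noteq> 0"
  proof -
    have "0 < M \<tau> x" using M_nonneg[OF x(1) \<tau>] x(2) by simp
    then have "simplex_sphere e n x 0 < 1" by (rule simplex_sphere_stereographic(1)[OF n M])
    then show ?thesis by (auto simp: nsphere_base_def)
  qed
  show "x = y" if x: "x \<in> geo K" "M \<tau> x \<noteq> 0" and y: "y \<in> geo K" "M \<tau> y \<noteq> 0"
    and eq: "simplex_sphere e n x = simplex_sphere e n y"
  proof
    fix v
    show "x v = y v"
    proof (cases "v \<in> \<tau>")
      case True
      then obtain i where i: "i < n" "v = e i" using im by auto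
      have "0 < Min (x ` e ` {..<n})" "0 < Min (y ` e ` {..<n})"
        unfolding M using M_nonneg[OF x(1) \<tau>] M_nonneg[OF y(1) \<tau>] x(2) y(2) by simp_all
      then show ?thesis
        using simplex_sphere_inj[OF n _ sum1[OF x] _ sum1[OF y] eq i(1)] i(2) by simp
    next
      case False
      then have "v \<notin> {u. x u \<noteq> 0}" "v \<notin> {u. y u \<noteq> 0}"
        by (simp_all only: support_eq_facet[OF x(1) \<tau> x(2)] support_eq_facet[OF y(1) \<tau> y(2)] not_False_eq_True)
      then show ?thesis by simp
    qed
  qed
  show "\<exists>x\<in>geo K. M \<tau> x \<noteq> 0 \<and> simplex_sphere e n x = z"
    if z: "z \<in> topspace (nsphere (n - 1))" "z \<noteq> nsphere_base"
  proof -
    obtain x where x: "\<And>v. 0 \<le> x v" "{v. x v \<noteq> 0} = e ` {..<n}" "sum x (e ` {..<n}) = 1"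
      "0 < Min (x ` e ` {..<n})" "simplex_sphere e n x = z"
      using simplex_sphere_surj[OF n inj z] by blast
    have "x \<in> geo K"
      using x(1,2,3) \<tau> finite_facet[OF \<tau>] im by (intro geoI[where V = \<tau>]) (auto simp: K_def)
    then show ?thesis using x(4,5) M by (intro bexI[of _ x]) auto
  qed
qed

text \<open>\<open>f\<close> takes each open facet bijectively onto its own sphere minus the base
  point and everything else to the base point. Only points outside the open facets are identified,
  and \<open>H\<close> moves these within themselves to the apex, as the quotient criterion
  demands.\<close>

theorem homotopy_equivalent_wedge:
  "geometric_realization K homotopy_equivalent_space
    wedge_topology (\<lambda>k::nat. nsphere (n - 1)) (\<lambda>k. nsphere_base) {..<card F}"
proof -
  let ?S = "topspace (nsphere (n - 1))"
  let ?W = "wedge_topology (\<lambda>k::nat. nsphere (n - 1)) (\<lambda>k. nsphere_base) {..<card F}"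
  let ?w = "wedge_inj (\<lambda>k::nat. nsphere_base)"
  obtain \<phi> where \<phi>: "bij_betw \<phi> {..<card F} F"
    using ex_bij_betw_nat_finite[OF F] by (auto simp: atLeast0LessThan)
  then have \<phi>F: "\<phi> k \<in> F" if "k < card F" for k using that by (auto simp: bij_betw_def)
  have "\<exists>e. bij_betw e {..<n} \<tau>" if "\<tau> \<in> F" for \<tau>
    using ex_bij_betw_nat_finite[OF finite_facet[OF that]] card_F[OF that]
    by (auto simp: atLeast0LessThan)
  then obtain e where e: "\<And>\<tau>. \<tau> \<in> F \<Longrightarrow> bij_betw (e \<tau>) {..<n} \<tau>" by metis
  define g where "g k = simplex_sphere (e (\<phi> k)) n" for k
  note sm = sphere_map[OF e[OF \<phi>F] \<phi>F, folded g_def]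
  have base: "nsphere_base \<in> ?S"
    using in_topspace_nsphere[of "n - 1"] by (simp add: nsphere_base_def)
  define f where "f x = (if \<exists>k<card F. M (\<phi> k) x \<noteq> 0
    then let k = (THE k. k < card F \<and> M (\<phi> k) x \<noteq> 0) in Some (k, g k x) else None)" for x
  have uniq: "k = l" if "x \<in> geo K" "k < card F" "l < card F" "M (\<phi> k) x \<noteq> 0" "M (\<phi> l) x \<noteq> 0" for x k l
  proof -
    have "\<phi> k = \<phi> l"
      using support_eq_facet[OF that(1) \<phi>F[OF that(2)] that(4)]
        support_eq_facet[OF that(1) \<phi>F[OF that(3)] that(5)] by simp
    then show ?thesis using \<phi> that(2,3) by (auto simp: bij_betw_def inj_on_def)
  qed
  have f_Some: "f x = Some (k, g k x)" if "x \<in> geo K" "k < card F" "M (\<phi> k) x \<noteq> 0" for x k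
  proof -
    have "(THE k. k < card F \<and> M (\<phi> k) x \<noteq> 0) = k"
      using that uniq[OF that(1)] by (intro the_equality) auto
    then show ?thesis using that(2,3) by (auto simp: f_def)
  qed
  have f_None: "f x = None" if "\<And>k. k < card F \<Longrightarrow> M (\<phi> k) x = 0" for x
    using that by (auto simp: f_def)
  have f_ex: "\<exists>k<card F. M (\<phi> k) x \<noteq> 0" if "f x \<noteq> None" for x
  proof (rule ccontr)
    assume "\<not> ?thesis"
    then have "f x = None" by (intro f_None) auto
    then show False using that by simp
  qed
  have f_None_M: "M \<tau> x = 0" if "x \<in> geo K" "f x = None" "\<tau> \<in> F" for x \<tau>
  proof -
    obtain k where "k < card F" "\<tau> = \<phi> k" using \<phi> \<open>\<tau> \<in> F\<close> by (auto simp: bij_betw_def)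
    then show ?thesis using f_Some[OF that(1), of k] that(2) by auto
  qed
  have f_inj: "f x = None \<or> x = y" if xy: "x \<in> geo K" "y \<in> geo K" "f x = f y" for x y
  proof (cases "\<exists>k<card F. M (\<phi> k) x \<noteq> 0")
    case True
    then obtain k where k: "k < card F" "M (\<phi> k) x \<noteq> 0" by blast
    then have fx: "f x = Some (k, g k x)" using f_Some xy(1) by blast
    then have "f y \<noteq> None" using xy(3) by simp
    then obtain l where l: "l < card F" "M (\<phi> l) y \<noteq> 0" using f_ex by blast
    then have "f y = Some (l, g l y)" using f_Some xy(2) by blast
    then have "l = k" "g k x = g k y" using fx xy(3) by auto
    then show ?thesis using sm(4)[OF k(1) k(1) xy(1,2) k(2)] l by simp
  next
    case False
    then have "f x = None" by (intro f_None) blast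
    then show ?thesis by simp
  qed
  have fw: "f x = ?w (k, g k x)" if "x \<in> geo K" "k < card F" "M (\<phi> k) x \<noteq> 0" for x k
    using f_Some[OF that] sm(3)[OF that(2) that(2) that(1) that(3)] by (simp add: wedge_inj_def)
  have w_None: "?w (k, g k x) = None" if "x \<in> geo K" "k < card F" "M (\<phi> k) x = 0" for x k
    using sm(2)[OF that(2) that(2) that(1) that(3)] by (simp add: wedge_inj_def)
  have g_in: "g k x \<in> ?S" if "x \<in> geo K" "k < card F" for x k
    using sm(1)[OF that(2) that(2)] that(1) by (auto simp: continuous_map_def)
  have f_in: "f x \<in> topspace ?W" if x: "x \<in> geo K" for x
  proof (cases "\<exists>k<card F. M (\<phi> k) x \<noteq> 0")
    case True
    then obtain k where k: "k < card F" "M (\<phi> k) x \<noteq> 0" by blast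
    then show ?thesis using fw[OF x k] g_in[OF x k(1)] by (auto simp: topspace_wedge_topology)
  next
    case False
    then show ?thesis using f_None[of x] by (auto simp: topspace_wedge_topology)
  qed
  let ?Y = "top_of_set (geo K)"
  have cont_f: "continuous_map ?Y ?W f"
    unfolding continuous_map_def
  proof (intro conjI allI impI)
    show "f \<in> topspace ?Y \<rightarrow> topspace ?W" using f_in by simp
    fix U assume U: "openin ?W U"
    have part: "openin ?Y {x \<in> topspace ?Y. ?w (k, g k x) \<in> U}" if k: "k < card F" for k
    proof -
      have "openin (nsphere (n - 1)) {y \<in> ?S. ?w (k, y) \<in> U}"
        using U k by (auto simp: openin_wedge_topology)
      then have "openin ?Y {x \<in> topspace ?Y. g k x \<in> {y \<in> ?S. ?w (k, y) \<in> U}}"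
        using sm(1)[OF k k] by (auto simp only: continuous_map_def)
      moreover have "{x \<in> topspace ?Y. g k x \<in> {y \<in> ?S. ?w (k, y) \<in> U}} =
          {x \<in> topspace ?Y. ?w (k, g k x) \<in> U}"
        using g_in[OF _ k] by auto
      ultimately show ?thesis by simp
    qed
    \<comment> \<open>At each point all but at most one of the maps \<open>g k\<close> take the base
      point as value. So the preimage of \<open>U\<close> is a finite intersection of the preimages
      for the single summands if \<open>None\<close> is in \<open>U\<close>, and their union
      otherwise.\<close>
    show "openin ?Y {x \<in> topspace ?Y. f x \<in> U}"
    proof (cases "None \<in> U")
      case True
      have iff: "f x \<in> U \<longleftrightarrow> (\<forall>k<card F. ?w (k, g k x) \<in> U)" if x: "x \<in> geo K" for x
      proof (cases "\<exists>k<card F. M (\<phi> k) x \<noteq> 0")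
        case ex: True
        then obtain k where k: "k < card F" "M (\<phi> k) x \<noteq> 0" by blast
        have "?w (l, g l x) \<in> U" if "l < card F" "l \<noteq> k" for l
        proof -
          have "M (\<phi> l) x = 0" using uniq[OF x that(1) k(1) _ k(2)] that(2) by blast
          then have "?w (l, g l x) = None" by (rule w_None[OF x that(1)])
          then show ?thesis using True by simp
        qed
        then show ?thesis using fw[OF x k] k(1) by metis
      next
        case False
        then have "f x = None" "\<And>k. k < card F \<Longrightarrow> ?w (k, g k x) = None"
          using f_ex[of x] w_None[OF x] by blast+
        then show ?thesis using True by simp
      qed
      have "{x \<in> topspace ?Y. f x \<in> U} =
          topspace ?Y \<inter> (\<Inter>k\<in>{..<card F}. {x \<in> topspace ?Y. ?w (k, g k x) \<in> U})"
        using iff by auto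
      moreover have "openin ?Y (topspace ?Y \<inter> (\<Inter>k\<in>{..<card F}. {x \<in> topspace ?Y. ?w (k, g k x) \<in> U}))"
        using part by (intro openin_Int_Inter) (auto simp del: topspace_euclidean_subtopology)
      ultimately show ?thesis by simp
    next
      case False
      have "{x \<in> topspace ?Y. f x \<in> U} = (\<Union>k\<in>{..<card F}. {x \<in> topspace ?Y. ?w (k, g k x) \<in> U})"
      proof (intro subset_antisym subsetI)
        fix x assume x: "x \<in> {x \<in> topspace ?Y. f x \<in> U}"
        then have "f x \<noteq> None" using False by (cases "f x = None") simp_all
        then obtain k where "k < card F" "M (\<phi> k) x \<noteq> 0" using f_ex by blast
        then show "x \<in> (\<Union>k\<in>{..<card F}. {x \<in> topspace ?Y. ?w (k, g k x) \<in> U})"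
          using x fw[of x k] by auto
      next
        fix x assume "x \<in> (\<Union>k\<in>{..<card F}. {x \<in> topspace ?Y. ?w (k, g k x) \<in> U})"
        then obtain k where k: "k < card F" "x \<in> geo K" "?w (k, g k x) \<in> U" by auto
        then have "M (\<phi> k) x \<noteq> 0" using w_None[of x k] False by auto
        then show "x \<in> {x \<in> topspace ?Y. f x \<in> U}" using fw[of x k] k by simp
      qed
      moreover have "openin ?Y (\<Union>k\<in>{..<card F}. {x \<in> topspace ?Y. ?w (k, g k x) \<in> U})"
        using part by (intro openin_Union) (auto simp del: topspace_euclidean_subtopology)
      ultimately show ?thesis by simp
    qed
  qed
  have surj: "f ` topspace ?Y = topspace ?W"
  proof (intro subset_antisym subsetI)
    fix y assume "y \<in> f ` topspace ?Y"
    then show "y \<in> topspace ?W" using f_in by auto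
  next
    fix y assume "y \<in> topspace ?W"
    then consider "y = None" | k z where "k < card F" "z \<in> ?S" "y = ?w (k, z)"
      unfolding topspace_wedge_topology by auto
    \<comment> \<open>The apex lies in no facet, so it reaches the base point even when there are no
      spheres.\<close>
    moreover have "None \<in> f ` topspace ?Y"
    proof -
      let ?c = "\<lambda>u. if u = c then 1 else 0 :: real"
      have "?c \<in> geo K"
        using C(2) by (intro geoI[where V = "{c}"]) (auto simp: K_def)
      moreover have "M \<tau> ?c = 0" if "\<tau> \<in> F" for \<tau>
      proof -
        obtain u where "u \<in> \<tau>" "M \<tau> ?c = ?c u" by (rule M_attained[OF \<open>\<tau> \<in> F\<close>])
        then show ?thesis using c_F[OF that] by auto
      qed
      then have "f ?c = None" using \<phi>F by (intro f_None) auto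
      ultimately show ?thesis by (intro image_eqI[of _ _ ?c]) auto
    qed
    ultimately show "y \<in> f ` topspace ?Y"
    proof cases
      case 2
      show ?thesis
      proof (cases "z = nsphere_base")
        case True
        then show ?thesis using 2 \<open>None \<in> f ` topspace ?Y\<close> by (simp add: wedge_inj_def)
      next
        case False
        obtain x where x: "x \<in> geo K" "M (\<phi> k) x \<noteq> 0" "g k x = z"
          using sm(5)[OF 2(1) 2(1) 2(2) False] by blast
        then have "f x = y" using fw[OF x(1) 2(1) x(2)] 2(3) by simp
        then show ?thesis using x(1) by auto
      qed
    qed simp
  qed
  have "?Y homotopy_equivalent_space ?W"
  proof (rule homotopy_equivalent_space_quotient[OF _ _ cont_f surj])
    show "compact_space ?Y"
      using compact_geo[OF simplicial_K] by (simp add: compact_space_subtopology)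
    have "Hausdorff_space (nsphere (n - 1))"
      by (simp add: nsphere euclidean_product_topology Hausdorff_space_subtopology)
    then show "Hausdorff_space ?W"
      using base by (intro Hausdorff_space_wedge_topology)
    show "continuous_map (prod_topology (top_of_set {0..1}) ?Y) ?Y H"
      using continuous_on_H H_in by auto
    show "H (0, x) = x" if "x \<in> topspace ?Y" for x using that H_0 by simp
    show "H (1, x) = H (1, y)" if "x \<in> topspace ?Y" "y \<in> topspace ?Y" "f x = f y" for x y
      using f_inj[of x y] that H_1_cone[of x] H_1_cone[of y] f_None_M[of x] f_None_M[of y] by auto
    show "f (H (t, x)) = f (H (t, y))"
      if t: "t \<in> {0..1}" and x: "x \<in> topspace ?Y" "y \<in> topspace ?Y" "f x = f y" for t x y
    proof (cases "x = y")
      case False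
      then have "f x = None" "f y = None" using f_inj[of x y] x by auto
      then have "f (H (t, x)) = None" "f (H (t, y)) = None"
        using f_None_M[of x] f_None_M[of y] x t \<phi>F by (auto intro!: f_None H_cone)
      then show ?thesis by simp
    qed simp
  qed
  then show ?thesis by (simp add: geometric_realization_eq)
qed

end

theorem spherical_imp_homotopic_to_wedge_of_spheres:
  fixes K :: "'a set set"
  assumes K: "spherical m n K" "K \<noteq> {}" and n: "0 < n" and inf: "infinite (UNIV :: 'a set)"
  shows "homotopic_to_wedge_of_spheres (geometric_realization K) m (int n - 1)"
proof -
  obtain F where facets: "F \<subseteq> K" "card F = m" "\<forall>\<tau>\<in>F. card \<tau> = n" "expands {} (K - F)"
    using K(1) unfolding spherical_def by (elim conjE exE)
  define C where "C = K - F"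
  have sK: "simplicial K" using K(1) by (rule spherical_simplicial)
  have sC: "simplicial C" using expands_simplicial[OF facets(4)] by (simp add: C_def)
  have "{} \<in> K" using simplicialD(4)[OF sK K(2)] .
  then have "{} \<in> C" using facets(3) n by (auto simp: C_def)
  have "finite (\<Union>K)" using simplicialD(1,2)[OF sK] by (intro finite_Union)
  \<comment> \<open>An infinite vertex type always leaves room for a new apex.\<close>
  then obtain c where c: "c \<notin> \<Union>K" using ex_new_if_finite[OF inf] by blast
  have fin: "finite F" using finite_subset[OF facets(1) simplicialD(1)[OF sK]] .
  interpret facets_on_cone C F c n
  proof
    show "\<rho> \<in> C" if "\<tau> \<in> F" "\<rho> \<subset> \<tau>" for \<tau> \<rho>
    proof -
      have "\<tau> \<in> K" using facets(1) that by blast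
      then have "finite \<tau>" "\<rho> \<in> K" using simplicialD(2,3)[OF sK] that by blast+
      moreover have "card \<rho> < card \<tau>" using psubset_card_mono[OF \<open>finite \<tau>\<close> that(2)] .
      ultimately show ?thesis using facets(3) that(1) unfolding C_def by auto
    qed
  qed (use sC \<open>{} \<in> C\<close> fin n facets c in \<open>auto simp: C_def\<close>)
  have "expands (K \<union> insert c ` {}) (K \<union> insert c ` C)"
    using facets(4) sK c by (intro expands_cone) (auto simp: C_def)
  then have "expands K (K \<union> insert c ` C)" by simp
  then have "geometric_realization (K \<union> insert c ` C) homotopy_equivalent_space geometric_realization K"
    by (rule expands_homotopy_equivalent[OF _ K(2)])
  then have "geometric_realization K homotopy_equivalent_space geometric_realization (K \<union> insert c ` C)"
    by (subst homotopy_equivalent_space_sym)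
  moreover have "K \<union> insert c ` C = facets_on_cone.K C F c"
    unfolding K_def unfolding C_def using facets(1) by auto
  ultimately have "geometric_realization K homotopy_equivalent_space
      wedge_topology (\<lambda>k::nat. nsphere (n - 1)) (\<lambda>k. nsphere_base) {..<m}"
    using homotopy_eqv_trans[OF _ homotopy_equivalent_wedge] facets(2) by simp
  moreover have "nat (int n - 1) = n - 1" by simp
  ultimately show ?thesis using n by (simp add: homotopic_to_wedge_of_spheres_def)
qed


section \<open>Order complexes of ranked posets\<close>

lemma simplicial_order_complex:
  assumes "finite P" shows "simplicial (order_complex P le)"
proof -
  have "order_complex P le \<subseteq> Pow P" by (auto simp: order_complex_def)
  then have "finite (order_complex P le)" using assms by (meson finite_Pow_iff finite_subset)
  moreover have "\<rho> \<in> order_complex P le" if "\<sigma> \<in> order_complex P le" "\<rho> \<subseteq> \<sigma>" for \<sigma> \<rho>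
    using that by (auto simp: order_complex_def intro: finite_subset chain_subset)
  moreover have "finite \<sigma>" if "\<sigma> \<in> order_complex P le" for \<sigma>
    using that by (simp add: order_complex_def)
  ultimately show ?thesis unfolding simplicial_def by simp
qed

lemma order_complex_empty [simp]: "order_complex {} le = {{}}"
  by (auto simp: order_complex_def Complete_Partial_Order.chain_def)

lemma order_complex_mono: "P \<subseteq> Q \<Longrightarrow> order_complex P le \<subseteq> order_complex Q le"
  by (auto simp: order_complex_def)

lemma order_complex_insert:
  assumes "z \<notin> P" "le z z"
  shows "order_complex (insert z P) le =
    order_complex P le \<union> insert z ` order_complex {y \<in> P. le z y \<or> le y z} le"
proof (intro subset_antisym subsetI)
  fix \<sigma> assume \<sigma>: "\<sigma> \<in> order_complex (insert z P) le"
  show "\<sigma> \<in> order_complex P le \<union> insert z ` order_complex {y \<in> P. le z y \<or> le y z} le"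
  proof (cases "z \<in> \<sigma>")
    case True
    have "\<sigma> - {z} \<in> order_complex {y \<in> P. le z y \<or> le y z} le"
      using \<sigma> True by (auto simp: order_complex_def Complete_Partial_Order.chain_def)
    then have "insert z (\<sigma> - {z}) \<in> insert z ` order_complex {y \<in> P. le z y \<or> le y z} le"
      by (rule imageI)
    then show ?thesis using True by (simp add: insert_absorb)
  next
    case False
    then show ?thesis using \<sigma> by (auto simp: order_complex_def)
  qed
next
  fix \<sigma> assume "\<sigma> \<in> order_complex P le \<union> insert z ` order_complex {y \<in> P. le z y \<or> le y z} le"
  then show "\<sigma> \<in> order_complex (insert z P) le"
  proof
    assume "\<sigma> \<in> order_complex P le"
    then show ?thesis using order_complex_mono[of P "insert z P" le] by auto
  next
    assume "\<sigma> \<in> insert z ` order_complex {y \<in> P. le z y \<or> le y z} le"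
    then obtain \<rho> where \<rho>: "\<rho> \<in> order_complex {y \<in> P. le z y \<or> le y z} le" "\<sigma> = insert z \<rho>" by blast
    then show ?thesis using assms(2) by (auto simp: order_complex_def Complete_Partial_Order.chain_def)
  qed
qed

lemma order_complex_image:
  assumes "inj_on g P" "\<And>x y. x \<in> P \<Longrightarrow> y \<in> P \<Longrightarrow> le' (g x) (g y) \<longleftrightarrow> le x y"
  shows "order_complex (g ` P) le' = (`) g ` order_complex P le"
proof (intro subset_antisym subsetI)
  fix \<sigma> assume \<sigma>: "\<sigma> \<in> order_complex (g ` P) le'"
  then obtain \<rho> where \<rho>: "\<rho> \<subseteq> P" "\<sigma> = g ` \<rho>" by (auto simp: order_complex_def subset_image_iff)
  then have "finite \<rho>"
    using \<sigma> inj_on_subset[OF assms(1) \<rho>(1)] by (simp add: order_complex_def finite_image_iff)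
  moreover have "Complete_Partial_Order.chain le \<rho>"
  proof (rule chainI)
    fix x y assume xy: "x \<in> \<rho>" "y \<in> \<rho>"
    then have "le' (g x) (g y) \<or> le' (g y) (g x)"
      using \<sigma> \<rho>(2) by (auto simp: order_complex_def Complete_Partial_Order.chain_def)
    then show "le x y \<or> le y x" using assms(2)[of x y] assms(2)[of y x] xy \<rho>(1) by auto
  qed
  ultimately show "\<sigma> \<in> (`) g ` order_complex P le"
    using \<rho> by (intro image_eqI[of _ _ \<rho>]) (auto simp: order_complex_def)
next
  fix \<sigma> assume "\<sigma> \<in> (`) g ` order_complex P le"
  then obtain \<rho> where \<rho>: "\<rho> \<in> order_complex P le" "\<sigma> = g ` \<rho>" by blast
  then show "\<sigma> \<in> order_complex (g ` P) le'"
    using assms(2) by (auto simp: order_complex_def Complete_Partial_Order.chain_def subset_iff)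
qed

lemma expands_order_complex_if_apex:
  assumes "finite P" "a \<in> P" "\<And>y. y \<in> P \<Longrightarrow> le a y \<or> le y a"
  shows "expands {} (order_complex P le)"
proof (rule expands_if_apex[OF simplicial_order_complex[OF assms(1)]])
  fix \<sigma> assume \<sigma>: "\<sigma> \<in> order_complex P le"
  show "insert a \<sigma> \<in> order_complex P le"
    unfolding order_complex_def
  proof (intro CollectI conjI chainI)
    fix x y assume "x \<in> insert a \<sigma>" "y \<in> insert a \<sigma>"
    moreover have "\<sigma> \<subseteq> P" "Complete_Partial_Order.chain le \<sigma>" using \<sigma> by (auto simp: order_complex_def)
    ultimately show "le x y \<or> le y x"
      using assms(2,3) by (auto simp: Complete_Partial_Order.chain_def)
  qed (use \<sigma> assms(2) in \<open>auto simp: order_complex_def\<close>)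
qed

text \<open>The strictly increasing rank yields antisymmetry, bounds the size of chains, and fixes
  the order in which elements moved by a closure operator are processed.\<close>

locale ranked_order =
  fixes W :: "'a set" and le :: "'a \<Rightarrow> 'a \<Rightarrow> bool" and r :: "'a \<Rightarrow> nat"
  assumes refl: "x \<in> W \<Longrightarrow> le x x"
    and trans: "x \<in> W \<Longrightarrow> y \<in> W \<Longrightarrow> z \<in> W \<Longrightarrow> le x y \<Longrightarrow> le y z \<Longrightarrow> le x z"
    and rank: "x \<in> W \<Longrightarrow> y \<in> W \<Longrightarrow> le x y \<Longrightarrow> x \<noteq> y \<Longrightarrow> r x < r y"
begin

text \<open>Distinct elements of a chain have distinct ranks, all strictly between \<open>a\<close>
  and \<open>b\<close>.\<close>

lemma card_face_le:
  assumes "\<sigma> \<in> order_complex P le" "P \<subseteq> W" "\<And>x. x \<in> P \<Longrightarrow> a < r x \<and> r x < b"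
  shows "card \<sigma> \<le> b - Suc a"
proof -
  have "inj_on r \<sigma>"
  proof (rule inj_onI, rule ccontr)
    fix x y assume xy: "x \<in> \<sigma>" "y \<in> \<sigma>" "r x = r y" "x \<noteq> y"
    then have "le x y \<or> le y x" "x \<in> W" "y \<in> W"
      using assms(1,2) by (auto simp: order_complex_def Complete_Partial_Order.chain_def)
    then show False using rank[of x y] rank[of y x] xy by auto
  qed
  then have "card \<sigma> = card (r ` \<sigma>)" by (simp add: card_image)
  also have "\<dots> \<le> card {a<..<b}"
    using assms by (intro card_mono) (auto simp: order_complex_def)
  finally show ?thesis by simp
qed

text \<open>Points moved by the closure operator \<open>f\<close> are added to the fixed points in the order of
  increasing rank, so that \<open>f z\<close> is an apex of the link of \<open>z\<close>.\<close>

lemma expands_closure: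
  assumes "finite P" "P \<subseteq> W" and f: "\<And>x. x \<in> P \<Longrightarrow> f x \<in> P" "\<And>x. x \<in> P \<Longrightarrow> le x (f x)"
    "\<And>x y. x \<in> P \<Longrightarrow> y \<in> P \<Longrightarrow> le x y \<Longrightarrow> le (f x) (f y)" "\<And>x. x \<in> P \<Longrightarrow> f (f x) = f x"
  shows "expands (order_complex {x \<in> P. f x = x} le) (order_complex P le)"
  using assms
proof (induction "card {x \<in> P. f x \<noteq> x}" arbitrary: P rule: less_induct)
  case less
  let ?N = "{x \<in> P. f x \<noteq> x}"
  show ?case
  proof (cases "?N = {}")
    case True
    then have "{x \<in> P. f x = x} = P" by auto
    then show ?thesis using expands.base[OF simplicial_order_complex[OF less.prems(1)]] by simp
  next
    case False
    have finN: "finite ?N" using less.prems(1) by simp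
    have "Max (r ` ?N) \<in> r ` ?N" using False finN by (intro Max_in) auto
    then obtain z where z: "z \<in> ?N" "Max (r ` ?N) = r z" unfolding image_iff by blast
    have max: "r y \<le> r z" if "y \<in> ?N" for y
      unfolding z(2)[symmetric] using finN that by (intro Max_ge) auto
    let ?P = "P - {z}"
    have zP: "z \<in> P" "f z \<noteq> z" using z by auto
    \<comment> \<open>\<open>z\<close> is not fixed, whereas every value of \<open>f\<close> is, so
      \<open>f\<close> still acts on the poset without \<open>z\<close>.\<close>
    have fP: "f x \<in> ?P" if "x \<in> ?P" for x
    proof -
      have "f x \<noteq> z" using less.prems(6)[of x] that zP by auto
      then show ?thesis using less.prems(3)[of x] that by auto
    qed
    have "{x \<in> ?P. f x \<noteq> x} \<subset> ?N" using z by blast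
    then have "card {x \<in> ?P. f x \<noteq> x} < card ?N" by (rule psubset_card_mono[OF finN])
    then have "expands (order_complex {x \<in> ?P. f x = x} le) (order_complex ?P le)"
      by (rule less.hyps) (use less.prems fP in auto)
    moreover have "{x \<in> ?P. f x = x} = {x \<in> P. f x = x}" using zP by auto
    ultimately have IH: "expands (order_complex {x \<in> P. f x = x} le) (order_complex ?P le)" by simp
    let ?L = "{y \<in> ?P. le z y \<or> le y z}"
    have zW: "z \<in> W" "f z \<in> W" using zP(1) less.prems(2,3) by auto
    \<comment> \<open>What lies below \<open>z\<close> lies below \<open>f z\<close>. What lies
      strictly above \<open>z\<close> has larger rank, hence is fixed by the choice of
      \<open>z\<close>, and by monotonicity lies above \<open>f z\<close>.\<close>
    have apex: "le (f z) y \<or> le y (f z)" if y: "y \<in> ?L" for y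
    proof (cases "le y z")
      case True
      then have "le y (f z)"
        using trans[of y z "f z"] y less.prems(2,4) zP(1) zW by blast
      then show ?thesis by simp
    next
      case False
      then have "r z < r y" using y rank[of z y] zW less.prems(2) by auto
      then have "f y = y" using max[of y] y by force
      then show ?thesis using less.prems(5)[of z y] zP(1) y False by auto
    qed
    have "expands {} (order_complex ?L le)"
    proof (rule expands_order_complex_if_apex[where a = "f z" and le = le, OF _ _ apex])
      show "f z \<in> ?L" using less.prems(3,4)[of z] zP by simp
    qed (use less.prems(1) in auto)
    then have "expands (order_complex ?P le \<union> insert z ` {})
        (order_complex ?P le \<union> insert z ` order_complex ?L le)"
    proof (rule expands_cone)
      show "simplicial (order_complex ?P le)" using less.prems(1) by (simp add: simplicial_order_complex)
      show "order_complex ?L le \<subseteq> order_complex ?P le" by (rule order_complex_mono) auto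
      show "z \<notin> \<Union>(order_complex ?P le)" by (auto simp: order_complex_def)
    qed
    moreover have "order_complex (insert z ?P) le =
        order_complex ?P le \<union> insert z ` order_complex ?L le"
      by (rule order_complex_insert) (use refl zW in auto)
    moreover have "insert z ?P = P" using zP(1) by auto
    ultimately have "expands (order_complex ?P le) (order_complex P le)" by simp
    then show ?thesis by (rule expands_trans[OF _ IH])
  qed
qed

text \<open>The order complex grows by a cone over that of the link \<open>L\<close>. The rank
  window from \<open>a\<close> to \<open>b\<close> supplies the dimension bound on \<open>L\<close>
  that \<open>spherical_cone\<close> asks for.\<close>

lemma spherical_insert:
  assumes P: "finite P" "P \<subseteq> W" "spherical m (Suc n) (order_complex P le)" and z: "z \<in> W" "z \<notin> P"
    and L: "{y \<in> P. le z y \<or> le y z} = L" "spherical m' n (order_complex L le)"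
    and ranks: "\<And>x. x \<in> L \<Longrightarrow> a < r x \<and> r x < b" "b - Suc a \<le> n"
  shows "spherical (m + m') (Suc n) (order_complex (insert z P) le)"
proof -
  have "order_complex (insert z P) le = order_complex P le \<union> insert z ` order_complex L le"
    unfolding L(1)[symmetric] by (rule order_complex_insert[of z P le, OF z(2) refl[OF z(1)]])
  moreover have "spherical (m + m') (Suc n) (order_complex P le \<union> insert z ` order_complex L le)"
  proof (rule spherical_cone[OF P(3) L(2)])
    have LP: "L \<subseteq> P" using L(1) by blast
    then show "order_complex L le \<subseteq> order_complex P le" by (rule order_complex_mono)
    show "\<forall>\<sigma>\<in>order_complex L le. card \<sigma> \<le> n"
      using card_face_le[of _ L a b] LP P(2) ranks by fastforce
    show "z \<notin> \<Union>(order_complex P le)" using z(2) by (auto simp: order_complex_def)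
  qed simp
  ultimately show ?thesis by simp
qed

end


section \<open>Words over the poset\<close>

text \<open>Passing to the recursive description allows reasoning letter by letter. For the harder
  direction the first index decides: if \<open>f 0 = 0\<close> the head of the larger word is
  matched, otherwise it is skipped; in both cases the remaining indices drop by one.\<close>

lemma subword_le_eq_list_emb: "subword_le le = list_emb le"
proof (intro ext iffI)
  fix u w
  assume "list_emb le u w"
  then show "subword_le le u w"
  proof induction
    case (list_emb_Nil ys)
    then show ?case by (simp add: subword_le_def strict_mono_on_def)
  next
    case (list_emb_Cons xs ys y)
    then obtain f where f: "strict_mono_on {..<length xs} f"
      "\<And>t. t < length xs \<Longrightarrow> f t < length ys \<and> le (xs ! t) (ys ! f t)"
      by (auto simp: subword_le_def)
    show ?case
      unfolding subword_le_def
      by (intro exI[of _ "\<lambda>t. Suc (f t)"]) (use f in \<open>auto simp: strict_mono_on_def\<close>)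
  next
    case (list_emb_Cons2 x y xs ys)
    then obtain f where f: "strict_mono_on {..<length xs} f"
      "\<And>t. t < length xs \<Longrightarrow> f t < length ys \<and> le (xs ! t) (ys ! f t)"
      by (auto simp: subword_le_def)
    show ?case
      unfolding subword_le_def
    proof (intro exI[of _ "\<lambda>t. case t of 0 \<Rightarrow> 0 | Suc t \<Rightarrow> Suc (f t)"] conjI allI impI)
      show "strict_mono_on {..<length (x # xs)} (\<lambda>t. case t of 0 \<Rightarrow> 0 | Suc t \<Rightarrow> Suc (f t))"
        using f(1) by (auto simp: strict_mono_on_def split: nat.splits)
    qed (use f(2) list_emb_Cons2 in \<open>auto split: nat.splits\<close>)
  qed
next
  fix u w
  assume "subword_le le u w"
  then show "list_emb le u w"
  proof (induction w arbitrary: u)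
    case Nil
    then show ?case by (cases u) (auto simp: subword_le_def)
  next
    case (Cons y ys)
    then obtain f where f: "strict_mono_on {..<length u} f"
      "\<And>t. t < length u \<Longrightarrow> f t < length (y # ys) \<and> le (u ! t) ((y # ys) ! f t)"
      by (auto simp: subword_le_def)
    show ?case
    proof (cases u)
      case Nil
      then show ?thesis by simp
    next
      case u: (Cons x xs)
      have less: "f t < f t'" if "t < t'" "t' < length u" for t t'
        using f(1) that by (auto simp: strict_mono_on_def)
      show ?thesis
      proof (cases "f 0")
        case 0
        have pos: "0 < f (Suc t)" if "t < length xs" for t
          using less[of 0 "Suc t"] that u by simp
        have "subword_le le xs ys"
          unfolding subword_le_def
        proof (intro exI[of _ "\<lambda>t. f (Suc t) - 1"] conjI allI impI)
          show "strict_mono_on {..<length xs} (\<lambda>t. f (Suc t) - 1)"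
          proof (rule strict_mono_onI)
            fix t t' assume "t \<in> {..<length xs}" "t' \<in> {..<length xs}" "t < t'"
            then show "f (Suc t) - 1 < f (Suc t') - 1"
              using less[of "Suc t" "Suc t'"] pos[of t] u by simp
          qed
          fix t assume t: "t < length xs"
          then have "f (Suc t) < Suc (length ys)" "le (xs ! t) ((y # ys) ! f (Suc t))"
            using f(2)[of "Suc t"] u by auto
          then show "f (Suc t) - 1 < length ys" "le (xs ! t) (ys ! (f (Suc t) - 1))"
            using pos[OF t] by (simp_all add: nth_Cons')
        qed
        moreover have "le x y" using f(2)[of 0] u 0 by simp
        ultimately show ?thesis unfolding u using Cons.IH by blast
      next
        case (Suc k)
        have pos: "0 < f t" if "t < length u" for t
          using less[of 0 t] that Suc by (cases t) auto
        have "subword_le le u ys"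
          unfolding subword_le_def
        proof (intro exI[of _ "\<lambda>t. f t - 1"] conjI allI impI)
          show "strict_mono_on {..<length u} (\<lambda>t. f t - 1)"
          proof (rule strict_mono_onI)
            fix t t' assume "t \<in> {..<length u}" "t' \<in> {..<length u}" "t < t'"
            then show "f t - 1 < f t' - 1" using less[of t t'] pos[of t] by simp
          qed
          fix t assume t: "t < length u"
          then have "f t < Suc (length ys)" "le (u ! t) ((y # ys) ! f t)"
            using f(2)[of t] by auto
          then show "f t - 1 < length ys" "le (u ! t) (ys ! (f t - 1))"
            using pos[OF t] by (simp_all add: nth_Cons')
        qed
        then show ?thesis using Cons.IH by blast
      qed
    qed
  qed
qed

text \<open>If the heads can be matched, greedy matching leaves the tails; if not, all of
  \<open>x # xs\<close> embeds in \<open>ys\<close>. This makes raising the first letter to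
  \<open>T\<close> monotone.\<close>

lemma list_emb_ConsD_tl: "list_emb P (x # xs) (y # ys) \<Longrightarrow> list_emb P xs ys"
  by (cases "P x y") (auto dest: list_emb_ConsD intro: list_emb_append2)

section \<open>Intervals of words: ranks, sphere numbers and the induction on
  \<open>j\<close>\<close>

locale Lambda_words =
  fixes s :: nat
  assumes s: "1 \<le> s"
begin

abbreviation T :: nat where "T \<equiv> s + 1"
abbreviation W :: "nat list set" where "W \<equiv> lists (Lambda s)"
abbreviation emb :: "nat list \<Rightarrow> nat list \<Rightarrow> bool" where "emb \<equiv> list_emb (Lambda_le s)"

text \<open>\<open>T\<close> is two steps above the absence of a letter, every other letter one. As
  \<open>1^i\<close> has rank \<open>i\<close> and \<open>T^j\<close> has rank \<open>2 j\<close>,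
  chains in the open interval have at most \<open>2 j - i - 1\<close> elements, the origin of the
  dimension \<open>2 j - i - 2\<close>.\<close>

definition rk :: "nat list \<Rightarrow> nat" where
  "rk w = sum_list (map (\<lambda>a. if a = T then 2 else 1) w)"

definition I :: "nat list \<Rightarrow> nat list \<Rightarrow> nat list set" where
  "I u w = open_interval W emb u w"

lemma I_iff: "x \<in> I u w \<longleftrightarrow> x \<in> W \<and> emb u x \<and> u \<noteq> x \<and> emb x w \<and> x \<noteq> w"
  by (auto simp: I_def open_interval_def)

lemma rk_simps [simp]: "rk [] = 0" "rk (a # w) = (if a = T then 2 else 1) + rk w"
  by (simp_all add: rk_def)

lemma rk_replicate [simp]:
  "rk (replicate i 1) = i" "rk (replicate i (Suc 0)) = i" "rk (replicate i (Suc s)) = 2 * i"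
  using s by (induction i) auto

lemma rk_eq_0_iff: "rk w = 0 \<longleftrightarrow> w = []"
  by (cases w) auto

lemma rk_emb: "emb u w \<Longrightarrow> rk u \<le> rk w \<and> (rk u = rk w \<longrightarrow> u = w)"
  by (induction rule: list_emb.induct) (auto simp: Lambda_le_def rk_eq_0_iff)

sublocale ranked_order W emb rk
proof
  show "emb x x" if "x \<in> W" for x
    using that by (intro list_emb_refl) (auto simp: Lambda_le_def)
  show "emb x z" if "emb x y" "emb y z" for x y z
    by (rule list_emb_trans[OF _ that]) (auto simp: Lambda_le_def)
  show "rk x < rk y" if "emb x y" "x \<noteq> y" for x y
    using rk_emb[OF that(1)] that(2) by auto
qed

lemma emb_trans: "emb x y \<Longrightarrow> emb y z \<Longrightarrow> emb x z"
  by (rule list_emb_trans[of x y z "Lambda_le s"]) (auto simp: Lambda_le_def)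

lemma rk_less: "emb x y \<Longrightarrow> x \<noteq> y \<Longrightarrow> rk x < rk y"
  using rk_emb[of x y] by auto

lemma rk_I: "x \<in> I u w \<Longrightarrow> rk u < rk x \<and> rk x < rk w"
  by (auto simp: I_iff intro: rk_less)

lemma emb_replicate_T: "w \<in> W \<Longrightarrow> emb w (replicate j T) \<longleftrightarrow> length w \<le> j"
proof (induction w arbitrary: j)
  case (Cons a w)
  then show ?case by (cases j) (auto simp: Lambda_le_def Lambda_def)
qed simp

lemma finite_I: "finite (I u w)"
proof -
  have "I u w \<subseteq> {x. set x \<subseteq> Lambda s \<and> length x \<le> length w}"
    by (auto simp: I_iff dest: list_emb_length)
  then show ?thesis
    by (rule finite_subset) (simp add: finite_lists_length_le Lambda_def)
qed

lemma I_W: "I u w \<subseteq> W" by (auto simp: I_iff)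

lemma one_T: "1 \<in> Lambda s" "T \<in> Lambda s" "Lambda_le s 1 T" "a \<in> Lambda s \<Longrightarrow> Lambda_le s a T"
  "a \<in> Lambda s \<Longrightarrow> Lambda_le s a a" "1 \<noteq> T"
  using s by (auto simp: Lambda_def Lambda_le_def)

lemma replicate_W: "replicate i 1 \<in> W" "replicate i T \<in> W"
  using one_T by (auto simp: in_lists_conv_set)

lemma replicate_1_ne_T: "0 < i \<Longrightarrow> replicate i 1 \<noteq> replicate k T"
  using s by (cases i; cases k) auto

text \<open>\<open>sphere_count i j\<close> is the absolute value of \<open>\<langle>x\<^sup>j\<^sup>-\<^sup>i\<rangle> T\<^sup>s\<^sub>i\<^sub>+\<^sub>j\<close> in a form in which Pascal's rule gives
  its recursion; it is only meaningful for \<open>i \<le> j\<close> and \<open>1 \<le> j\<close>.\<close>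

definition sphere_count :: "nat \<Rightarrow> nat \<Rightarrow> nat" where
  "sphere_count i j = (if i = 0 then 0 else ((j - 1) choose (i - 1)) * s ^ (j - i)) +
     ((j - 1) choose i) * (s - 1) * s ^ (j - 1 - i)"

lemma sphere_count_Suc:
  assumes "1 \<le> k" "i \<le> k"
  shows "sphere_count i (Suc k) = s * sphere_count i k + (if 1 \<le> i then sphere_count (i - 1) k else 0)"
proof -
  define c where "c = s - 1"
  have w: "sphere_count i j = (if i = 0 then 0 else ((j - 1) choose (i - 1)) * s ^ (j - i)) +
     ((j - 1) choose i) * c * s ^ (j - 1 - i)" for i j
    by (simp add: sphere_count_def c_def)
  obtain l where k: "k = Suc l" using assms by (cases k) auto
  show ?thesis
  proof (cases i)
    case 0
    then show ?thesis by (simp add: w k)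
  next
    case i: (Suc h)
    \<comment> \<open>If \<open>Suc h > l\<close>, the exponent is truncated, but then the binomial
      coefficient is 0.\<close>
    have 1: "(l choose Suc h) * c * s ^ (l - h) = s * ((l choose Suc h) * c * s ^ (l - Suc h))"
    proof (cases "Suc h \<le> l")
      case True
      then have "s ^ (l - h) = s * s ^ (l - Suc h)" by (metis Suc_diff_Suc Suc_le_lessD power_Suc)
      then show ?thesis by simp
    qed (simp add: not_le binomial_eq_0)
    have 2: "s ^ (Suc l - h) = s * s ^ (l - h)"
      using assms(2) i k by (simp add: Suc_diff_le)
    show ?thesis
    proof (cases h)
      case 0
      then show ?thesis using 1 2 by (simp add: w k i algebra_simps)
    next
      case (Suc g)
      then have "sphere_count i (Suc k) = ((l choose h) + (l choose g)) * s ^ (Suc l - h) +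
          ((l choose h) + (l choose Suc h)) * c * s ^ (l - h)"
        by (simp add: w k i)
      then show ?thesis using 1 2 Suc by (simp add: w k i algebra_simps)
    qed
  qed
qed

lemma sphere_count_diag: "1 \<le> k \<Longrightarrow> sphere_count (Suc k) (Suc k) = sphere_count k k"
  by (cases k) (simp_all add: sphere_count_def)

text \<open>The two summands have separate sources: \<open>sphere_count i k\<close> comes from
  putting back \<open>T^k\<close>, which lies in the interval only if \<open>i \<le> k\<close>, and
  \<open>sphere_count (i - 1) k\<close> from the fixed points when \<open>a = 1\<close> and
  \<open>i > 0\<close>. For \<open>i = Suc k\<close> the letter must be 1 and only the second source
  is left.\<close>

lemma spherical_I_step_link:
  assumes k: "1 \<le> k" and i: "i \<le> Suc k" and a: "a \<in> {1..s}" "a = 1 \<or> i \<le> k"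
    and IH1: "i \<le> k \<Longrightarrow> spherical (sphere_count i k) (2 * k - i - 1)
      (order_complex (I (replicate i 1) (replicate k T)) emb)"
    and IH2: "1 \<le> i \<Longrightarrow> spherical (sphere_count (i - 1) k) (2 * k - (i - 1) - 1)
      (order_complex (I (replicate (i - 1) 1) (replicate k T)) emb)"
  shows "spherical ((if i \<le> k then sphere_count i k else 0) + (if a = 1 \<and> 1 \<le> i then sphere_count (i - 1) k else 0))
    (2 * k - i) (order_complex (I (replicate i 1) (a # replicate k T)) emb)"
proof -
  let ?u = "replicate i 1" and ?t = "replicate k T"
  let ?L = "I ?u (a # ?t)"
  let ?R = "?L - {?t}"
  let ?m = "if a = 1 \<and> 1 \<le> i then sphere_count (i - 1) k else 0"
  have aL: "a \<in> Lambda s" "a \<noteq> T" and a_max: "\<And>b. Lambda_le s b a \<Longrightarrow> b = a"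
    using a(1) by (auto simp: Lambda_def Lambda_le_def)
  have le_aa: "Lambda_le s a a" using one_T(5)[OF aL(1)] .
  have rk_a: "rk (a # ?t) = 2 * k + 1" using aL by simp
  have finR: "finite ?R" using finite_I by simp
  have RW: "?R \<subseteq> W" using I_W by blast
  have ne_t: "a # y \<noteq> ?t" for y using aL(2) k by (cases k) auto
  define g where "g x = (if x \<noteq> [] \<and> hd x = a then x else a # x)" for x
  \<comment> \<open>Only \<open>a\<close> itself lies below \<open>a\<close>, so a word that does
    not begin with \<open>a\<close> cannot use a leading \<open>a\<close>.\<close>
  have skip: "emb x y \<longleftrightarrow> emb x (a # y)" if "\<not> (x \<noteq> [] \<and> hd x = a)" for x y
  proof (cases x)
    case (Cons b z)
    then have "\<not> Lambda_le s b a" using that a_max by auto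
    then show ?thesis using Cons by simp
  qed simp
  have g_mem: "g x \<in> ?R" if x: "x \<in> ?R" for x
  proof (cases "x \<noteq> [] \<and> hd x = a")
    case False
    have xI: "x \<in> W" "emb ?u x" "?u \<noteq> x" "emb x (a # ?t)" "x \<noteq> ?t" using x by (auto simp: I_iff)
    then have "emb (a # x) (a # ?t)" using skip[OF False] le_aa by simp
    moreover have "a # x \<in> W" using xI(1) aL(1) by simp
    moreover have "emb ?u (a # x)" using xI(2) by blast
    moreover have "?u \<noteq> a # x"
    proof
      assume "?u = a # x"
      then have "rk ?u = Suc (rk x)" using aL(2) by simp
      then show False using rk_less[OF xI(2,3)] by simp
    qed
    ultimately have "a # x \<in> ?R" using xI(5) ne_t by (simp add: I_iff)
    moreover have "g x = a # x" unfolding g_def using False by (rule if_not_P)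
    ultimately show ?thesis by simp
  qed (use x in \<open>simp add: g_def\<close>)
  have g_le: "emb x (g x)" if "x \<in> ?R" for x
    using refl[of x] RW that unfolding g_def by (auto intro: list_emb_Cons)
  have g_mono: "emb (g x) (g y)" if x: "x \<in> ?R" and y: "y \<in> ?R" and xy: "emb x y" for x y
  proof (cases "x \<noteq> [] \<and> hd x = a")
    case True
    then have "g x = x" by (simp add: g_def)
    then show ?thesis using emb_trans[OF xy g_le[OF y]] by simp
  next
    case x_ne: False
    show ?thesis
    proof (cases "y \<noteq> [] \<and> hd y = a")
      case True
      then obtain z where z: "y = a # z" by (cases y) auto
      then have "emb x z" using xy skip[OF x_ne] by simp
      moreover have "g x = a # x" unfolding g_def using x_ne by (rule if_not_P)
      moreover have "g y = y" using True by (simp add: g_def)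
      ultimately show ?thesis using z le_aa by simp
    next
      case False
      have "g x = a # x" unfolding g_def using x_ne by (rule if_not_P)
      moreover have "g y = a # y" unfolding g_def using False by (rule if_not_P)
      ultimately show ?thesis using xy le_aa by simp
    qed
  qed
  have fix_iff: "g x = x \<longleftrightarrow> (\<exists>y. x = a # y)" for x by (cases x) (auto simp: g_def)
  have ex: "expands (order_complex {x \<in> ?R. g x = x} emb) (order_complex ?R emb)"
    by (rule expands_closure[OF finR RW g_mem g_le g_mono]) (simp_all add: g_def)
  have dim: "\<forall>\<sigma>\<in>order_complex ?R emb. card \<sigma> \<le> 2 * k - i"
  proof
    fix \<sigma> assume "\<sigma> \<in> order_complex ?R emb"
    then have "card \<sigma> \<le> (2 * k + 1) - Suc i"
    proof (rule card_face_le[OF _ RW])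
      show "i < rk x \<and> rk x < 2 * k + 1" if "x \<in> ?R" for x
        using rk_I[of x ?u "a # ?t"] that rk_a by simp
    qed
    then show "card \<sigma> \<le> 2 * k - i" by simp
  qed
  have R: "spherical ?m (2 * k - i) (order_complex ?R emb)"
  proof (cases "a = 1 \<and> 1 \<le> i")
    case True
    then obtain h where h: "i = Suc h" by (cases i) auto
    have Fix: "{x \<in> ?R. g x = x} = Cons a ` I (replicate h 1) ?t"
    proof (intro set_eqI)
      fix x
      have "x \<in> {x \<in> ?R. g x = x} \<longleftrightarrow> (\<exists>y. x = a # y \<and> a # y \<in> ?R)"
        unfolding mem_Collect_eq fix_iff by (intro iffI; elim conjE exE) auto
      also have "\<dots> \<longleftrightarrow> (\<exists>y. x = a # y \<and> y \<in> I (replicate h 1) ?t)"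
        using ne_t True aL(1) le_aa by (simp add: I_iff h)
      finally show "x \<in> {x \<in> ?R. g x = x} \<longleftrightarrow> x \<in> Cons a ` I (replicate h 1) ?t" by blast
    qed
    have "order_complex (Cons a ` I (replicate h 1) ?t) emb =
        (`) (Cons a) ` order_complex (I (replicate h 1) ?t) emb"
      by (rule order_complex_image) (use le_aa in auto)
    moreover have "spherical (sphere_count h k) (2 * k - i) (order_complex (I (replicate h 1) ?t) emb)"
      using IH2 h by simp
    then have "spherical (sphere_count h k) (2 * k - i) ((`) (Cons a) ` order_complex (I (replicate h 1) ?t) emb)"
      by (rule spherical_image) (simp add: inj_on_def)
    ultimately have "spherical (sphere_count h k) (2 * k - i) (order_complex {x \<in> ?R. g x = x} emb)"
      unfolding Fix by simp
    then show ?thesis using spherical_expands[OF _ ex dim] True h by simp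
  next
    case False
    then have ik: "i \<le> k" and i0: "a = 1 \<Longrightarrow> i = 0" using a(2) by auto
    \<comment> \<open>Either \<open>a\<close> differs from 1 or \<open>i = 0\<close>; in both cases
      a leading \<open>a\<close> is of no use for embedding \<open>1^i\<close>, and
      \<open>a 1^i\<close> becomes the least fixed point.\<close>
    have below: "emb ?u (a # y) \<longleftrightarrow> emb ?u y" for y
      using skip[of ?u y] i0 by (cases i) auto
    have apex: "emb (a # ?u) x" if x: "x \<in> {x \<in> ?R. g x = x}" for x
    proof -
      obtain y where "x = a # y" using x fix_iff[of x] by auto
      then show ?thesis using x below[of y] le_aa by (simp add: I_iff)
    qed
    have "a # ?u \<in> ?R"
    proof -
      have "?u \<noteq> ?t" using replicate_1_ne_T[of k i] k
        by (metis length_replicate less_le_trans zero_less_one replicate_1_ne_T)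
      moreover have "emb ?u ?t" using emb_replicate_T[OF replicate_W(1)] ik by simp
      moreover have "emb ?u ?u" using refl[OF replicate_W(1)] .
      moreover have "?u \<noteq> a # ?u" by (metis not_Cons_self)
      ultimately show ?thesis
        using ne_t[of ?u] replicate_W(1)[of i] aL(1) le_aa below by (simp add: I_iff)
    qed
    then have "a # ?u \<in> {x \<in> ?R. g x = x}" unfolding mem_Collect_eq fix_iff by blast
    then have "expands {} (order_complex {x \<in> ?R. g x = x} emb)"
      using finR apex by (intro expands_order_complex_if_apex) auto
    then have "expands {} (order_complex ?R emb)" by (rule expands_trans[OF ex])
    then show ?thesis unfolding if_not_P[OF False] by (rule spherical_0)
  qed
  show ?thesis
  proof (cases "i \<le> k")
    case True
    have t_L: "?t \<in> ?L"
    proof -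
      have "?u \<noteq> ?t" using k
        by (metis length_replicate less_le_trans zero_less_one replicate_1_ne_T)
      moreover have "emb ?u ?t" using emb_replicate_T[OF replicate_W(1)] True by simp
      moreover have "emb ?t (a # ?t)" using refl[OF replicate_W(2)] by blast
      ultimately show ?thesis using replicate_W(2) ne_t[of ?t] by (auto simp: I_iff)
    qed
    \<comment> \<open>\<open>T^k\<close> has rank \<open>2 k\<close>, the largest possible below
      \<open>a T^k\<close>, so nothing else in the interval lies above it.\<close>
    have link: "{y \<in> ?R. emb ?t y \<or> emb y ?t} = I ?u ?t"
    proof (intro subset_antisym subsetI)
      fix y assume y: "y \<in> {y \<in> ?R. emb ?t y \<or> emb y ?t}"
      have "\<not> emb ?t y"
      proof
        assume "emb ?t y"
        then have "2 * k < rk y" using rk_less[of ?t y] y by auto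
        then show False using rk_I[of y ?u "a # ?t"] y rk_a by simp
      qed
      then show "y \<in> I ?u ?t" using y by (auto simp: I_iff)
    next
      fix y assume y: "y \<in> I ?u ?t"
      then have "emb y (a # ?t)" by (auto simp: I_iff intro: list_emb_Cons)
      moreover have "y \<noteq> a # ?t" using rk_I[OF y] rk_a by auto
      ultimately show "y \<in> {y \<in> ?R. emb ?t y \<or> emb y ?t}" using y by (auto simp: I_iff)
    qed
    have n: "2 * k - i = Suc (2 * k - i - 1)" using True k by simp
    have "spherical (?m + sphere_count i k) (Suc (2 * k - i - 1)) (order_complex (insert ?t ?R) emb)"
    proof (rule spherical_insert[OF finR RW _ replicate_W(2) _ link IH1[OF True], where a = i and b = "2 * k"])
      show "spherical ?m (Suc (2 * k - i - 1)) (order_complex ?R emb)" using R n by simp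
      show "i < rk x \<and> rk x < 2 * k" if "x \<in> I ?u ?t" for x using rk_I[OF that] by simp
    qed simp_all
    moreover have "insert ?t ?R = ?L" using t_L by blast
    ultimately show ?thesis using n True by (simp add: add.commute)
  next
    case False
    have "?t \<notin> ?L"
    proof
      assume "?t \<in> ?L"
      then have "length ?u \<le> length ?t" by (auto simp: I_iff dest: list_emb_length)
      then show False using False by simp
    qed
    then have "?R = ?L" by simp
    then show ?thesis using R False by simp
  qed
qed


text \<open>For \<open>i = 0\<close> the interval consists of \<open>s\<close> incomparable
  one-letter words: \<open>[1]\<close> alone is contractible, and each of the others is attached
  along an empty link, which gives \<open>s - 1\<close> spheres of dimension 0. For
  \<open>i = 1\<close> the interval is empty, a (-1)-sphere.\<close>

lemma spherical_I_1:
  assumes "i \<le> 1"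
  shows "spherical (sphere_count i 1) (1 - i) (order_complex (I (replicate i 1) [T]) emb)"
proof (cases "i = 0")
  case True
  have emb_T: "emb x [T] \<longleftrightarrow> length x \<le> 1" if "x \<in> W" for x
    using emb_replicate_T[OF that, of 1] by simp
  have I: "I [] [T] = (\<lambda>a. [a]) ` {1..s}"
  proof (intro subset_antisym subsetI)
    fix x assume "x \<in> I [] [T]"
    then have x: "x \<in> W" "x \<noteq> []" "x \<noteq> [T]" "length x \<le> 1" using emb_T by (auto simp: I_iff)
    then obtain a where "x = [a]" by (cases x) auto
    then show "x \<in> (\<lambda>a. [a]) ` {1..s}" using x by (auto simp: Lambda_def)
  next
    fix x assume "x \<in> (\<lambda>a. [a]) ` {1..s}"
    then obtain a where a: "x = [a]" "a \<in> {1..s}" by blast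
    then have "x \<in> W" by (auto simp: Lambda_def)
    then show "x \<in> I [] [T]" using a emb_T[of x] by (auto simp: I_iff)
  qed
  have sing: "emb [a] [b] \<longleftrightarrow> a = b" if "a \<in> {1..s}" "b \<in> {1..s}" for a b
    using that by (cases "Lambda_le s a b") (auto simp: Lambda_le_def Lambda_def)
  have "spherical (card A) 1 (order_complex ((\<lambda>a. [a]) ` insert 1 A) emb)" if "finite A" "A \<subseteq> {2..s}" for A
    using that
  proof (induction A rule: finite_induct)
    case empty
    have "expands {} (order_complex {[1]} emb)"
      using one_T by (intro expands_order_complex_if_apex[where a = "[1]"]) auto
    then show ?case using spherical_0 by simp
  next
    case (insert b A)
    have b: "b \<in> {1..s}" "b \<noteq> 1" using insert.prems by auto
    have "spherical (card A + 1) (Suc 0) (order_complex (insert [b] ((\<lambda>a. [a]) ` insert 1 A)) emb)"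
    \<comment> \<open>With an empty link the rank condition is vacuous, and \<open>a = b = 0\<close>
      gives the bound 0 on its faces.\<close>
    proof (rule spherical_insert[where L = "{}" and a = 0 and b = 0])
      show "(\<lambda>a. [a]) ` insert 1 A \<subseteq> W" using insert.prems s by (auto simp: Lambda_def)
      show "spherical (card A) (Suc 0) (order_complex ((\<lambda>a. [a]) ` insert 1 A) emb)"
        using insert by simp
      show "[b] \<in> W" using b by (auto simp: Lambda_def)
      show "[b] \<notin> (\<lambda>a. [a]) ` insert 1 A" using b insert.hyps by auto
      show "{y \<in> (\<lambda>a. [a]) ` insert 1 A. emb [b] y \<or> emb y [b]} = {}"
      proof -
        have "a \<in> {1..s}" "a \<noteq> b" if "a \<in> insert 1 A" for a
          using that insert b s by auto
        then show ?thesis using sing b(1) by blast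
      qed
      show "spherical 1 0 (order_complex {} emb)" using spherical_empty_face by simp
    qed (use insert.hyps in auto)
    moreover have "insert [b] ((\<lambda>a. [a]) ` insert 1 A) = (\<lambda>a. [a]) ` insert 1 (insert b A)" by auto
    ultimately show ?case using insert.hyps by simp
  qed
  from this[of "{2..s}"] have "spherical (s - 1) 1 (order_complex ((\<lambda>a. [a]) ` insert 1 {2..s}) emb)"
    by simp
  moreover have "insert 1 {2..s} = {1..s}" using s by auto
  ultimately have "spherical (s - 1) 1 (order_complex ((\<lambda>a. [a]) ` {1..s}) emb)" by metis
  then show ?thesis using True I by (simp add: sphere_count_def)
next
  case False
  then have i: "i = 1" using assms by simp
  have "x \<notin> I [1] [T]" for x using rk_I[of x "[1]" "[T]"] s by auto
  then have "I [1] [T] = {}" by blast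
  then show ?thesis using spherical_empty_face i by (simp add: sphere_count_def)
qed

text \<open>The induction starts at \<open>j = 1\<close>: in a step from \<open>k = 0\<close> the
  least fixed point \<open>T 1^(i-1)\<close> used below would be the top of the interval.\<close>

lemma spherical_I:
  assumes "1 \<le> j" "i \<le> j"
  shows "spherical (sphere_count i j) (2 * j - i - 1)
    (order_complex (I (replicate i 1) (replicate j T)) emb)"
  using assms
proof (induction j arbitrary: i rule: nat_induct_at_least)
  case base
  then show ?case using spherical_I_1[of i] by simp
next
  case (Suc k)
  let ?u = "replicate i 1" and ?t = "replicate k T"
  let ?I = "I ?u (T # ?t)"
  let ?Q = "?I - (\<lambda>a. a # ?t) ` {1..s}"
  let ?n = "2 * k - i"
  have n: "2 * Suc k - i - 1 = Suc ?n" using Suc.prems Suc.hyps by simp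
  have finQ: "finite ?Q" using finite_I by simp
  have QW: "?Q \<subseteq> W" using I_W by blast
  have emb_top: "emb x (T # ?t) \<longleftrightarrow> length x \<le> Suc k" if "x \<in> W" for x
    using emb_replicate_T[OF that, of "Suc k"] by simp
  define f where "f x = T # tl x" for x
  have Q_ne: "x \<noteq> []" if "x \<in> ?Q" for x using that by (cases i) (auto simp: I_iff)
  have f_mem: "f x \<in> ?Q" and f_le: "emb x (f x)" if x: "x \<in> ?Q" for x
  proof -
    obtain b y where xeq: "x = b # y" using Q_ne[OF x] by (cases x) auto
    have xI: "x \<in> W" "emb ?u x" "?u \<noteq> x" "emb x (T # ?t)" "x \<noteq> T # ?t" using x by (auto simp: I_iff)
    then have W: "b \<in> Lambda s" "y \<in> W" using xeq by auto
    then show le: "emb x (f x)" using one_T(4) refl[OF W(2)] by (simp add: f_def xeq)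
    have fW: "f x \<in> W" using W one_T(2) by (simp add: f_def xeq)
    moreover have "emb ?u (f x)" by (rule emb_trans[OF xI(2) le])
    moreover have "?u \<noteq> f x" using s by (cases i) (auto simp: f_def)
    moreover have "emb (f x) (T # ?t)"
      using emb_top[OF fW] emb_top[OF xI(1)] xI(4) by (simp add: f_def xeq)
    \<comment> \<open>Raising reaches the top only from words \<open>b T^k\<close>, which for
      \<open>b \<le> s\<close> are the coatoms taken out of \<open>?Q\<close>.\<close>
    moreover have "f x \<noteq> T # ?t"
    proof
      assume "f x = T # ?t"
      then have "y = ?t" by (simp add: f_def xeq)
      moreover have "b \<in> {1..s} \<or> b = T" using W(1) by (auto simp: Lambda_def)
      ultimately show False using x xI(5) xeq by auto
    qed
    moreover have "f x \<notin> (\<lambda>a. a # ?t) ` {1..s}" by (auto simp: f_def)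
    ultimately show "f x \<in> ?Q" by (simp add: I_iff)
  qed
  have f_mono: "emb (f x) (f y)" if x: "x \<in> ?Q" and y: "y \<in> ?Q" and xy: "emb x y" for x y
  proof -
    obtain b x' c y' where eqs: "x = b # x'" "y = c # y'"
      using Q_ne[OF x] Q_ne[OF y] by (cases x; cases y) auto
    have "emb x' y'" using xy unfolding eqs by (rule list_emb_ConsD_tl)
    then show ?thesis using one_T(2,5) by (simp add: f_def eqs)
  qed
  have ex: "expands (order_complex {x \<in> ?Q. f x = x} emb) (order_complex ?Q emb)"
    by (rule expands_closure[OF finQ QW f_mem f_le f_mono]) (simp_all add: f_def)
  \<comment> \<open>Since \<open>1\<close> lies below \<open>T\<close>, the word \<open>T y\<close>
    is above \<open>1^i\<close> iff \<open>y\<close> is above \<open>1^(i-1)\<close>. For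
    \<open>i = 0\<close> truncated subtraction makes the witness \<open>[T]\<close>, again the least
    fixed point.\<close>
  let ?a = "T # replicate (i - 1) 1"
  have "?a \<in> ?Q"
  proof -
    have aW: "?a \<in> W" using one_T(2) replicate_W(1) by simp
    moreover have "emb ?u ?a"
      using one_T(3) refl[OF replicate_W(1), of "i - 1"] by (cases i) auto
    moreover have "?u \<noteq> ?a" using s by (cases i) auto
    moreover have "emb ?a (T # ?t)" using emb_top[OF aW] Suc.prems by simp
    moreover have "?a \<noteq> T # ?t"
      using Suc.hyps s by (cases k; cases "i - 1") auto
    moreover have "?a \<notin> (\<lambda>a. a # ?t) ` {1..s}" by auto
    ultimately show ?thesis by (simp add: I_iff)
  qed
  then have a_fix: "?a \<in> {x \<in> ?Q. f x = x}" by (simp add: f_def)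
  have a_le: "emb ?a x" if x: "x \<in> {x \<in> ?Q. f x = x}" for x
  proof -
    have "x = T # tl x" using x unfolding f_def by simp
    then obtain y where y: "x = T # y" by blast
    then have "emb ?u (T # y)" using x by (simp add: I_iff)
    then have "emb (replicate (i - 1) 1) y" using one_T(3) by (cases i) auto
    then show ?thesis using one_T y by simp
  qed
  have "expands {} (order_complex {x \<in> ?Q. f x = x} emb)"
    using finQ a_fix a_le by (intro expands_order_complex_if_apex[where a = ?a]) auto
  then have Q0: "expands {} (order_complex ?Q emb)" by (rule expands_trans[OF ex])
  \<comment> \<open>These are the letters with \<open>a T^k\<close> above \<open>1^i\<close>: for
    \<open>a \<noteq> 1\<close> the first letter does not help, so all of \<open>1^i\<close> must
    fit into \<open>T^k\<close>.\<close>
  let ?S = "{a \<in> {1..s}. a = 1 \<or> i \<le> k}"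
  let ?m = "\<lambda>a. (if i \<le> k then sphere_count i k else 0) + (if a = 1 \<and> 1 \<le> i then sphere_count (i - 1) k else 0)"
  have small: "a # ?t \<in> W" "rk (a # ?t) = 2 * k + 1" if "a \<in> {1..s}" for a
    using that replicate_W(2)[of k] by (auto simp: Lambda_def)
  have S_I: "a # ?t \<in> ?I" if a: "a \<in> ?S" for a
  proof -
    have "emb ?u (a # ?t)"
    proof (cases i)
      case (Suc h)
      have hk: "h \<le> k" using Suc.prems Suc by simp
      show ?thesis
      proof (cases "a = 1")
        case True
        then show ?thesis using Suc hk one_T emb_replicate_T[OF replicate_W(1)] by simp
      next
        case False
        then have "emb ?u ?t" using a emb_replicate_T[OF replicate_W(1)] by simp
        then show ?thesis by blast
      qed
    qed simp
    moreover have "?u \<noteq> a # ?t"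
    proof
      assume eq: "?u = a # ?t"
      have "T \<in> set (a # ?t)" using Suc.hyps by (cases k) auto
      then have "T \<in> set ?u" unfolding eq .
      then show False using s by (auto split: if_splits)
    qed
    moreover have "a # ?t \<noteq> T # ?t" using a by auto
    moreover have aW: "a # ?t \<in> W" by (rule small(1)) (use a in simp)
    moreover have "emb (a # ?t) (T # ?t)" using emb_top[OF aW] by simp
    ultimately show ?thesis unfolding I_iff by (intro conjI)
  qed
  have add: "spherical (\<Sum>a\<in>A. ?m a) (Suc ?n) (order_complex (?Q \<union> (\<lambda>a. a # ?t) ` A) emb)"
    if "finite A" "A \<subseteq> ?S" for A
    using that
  proof (induction A rule: finite_induct)
    case empty
    then show ?case using spherical_0[OF Q0] by simp
  next
    case (insert b A)
    have b: "b \<in> {1..s}" "b = 1 \<or> i \<le> k" using insert.prems by auto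
    let ?P = "?Q \<union> (\<lambda>a. a # ?t) ` A"
    let ?L = "I ?u (b # ?t)"
    have AS: "A \<subseteq> ?S" using insert.prems by simp
    have P_I: "?P \<subseteq> ?I" using S_I AS by blast
    \<comment> \<open>All words \<open>a T^k\<close> with \<open>a \<le> s\<close> have rank
      \<open>2 k + 1\<close>, so those put back earlier are not comparable to \<open>b T^k\<close>.
      Everything between \<open>1^i\<close> and \<open>b T^k\<close> has smaller rank and was never
      removed.\<close>
    have link: "{y \<in> ?P. emb (b # ?t) y \<or> emb y (b # ?t)} = ?L"
    proof (intro subset_antisym subsetI)
      fix y assume y: "y \<in> {y \<in> ?P. emb (b # ?t) y \<or> emb y (b # ?t)}"
      then have yI: "y \<in> ?I" using P_I by blast
      have ne: "y \<noteq> b # ?t"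
        using y b(1) insert.hyps by auto
      have "\<not> emb (b # ?t) y"
      proof
        assume "emb (b # ?t) y"
        then have "2 * k + 1 < rk y" using rk_less ne small(2)[OF b(1)] by metis
        then show False using rk_I[OF yI] by simp
      qed
      then show "y \<in> ?L" using y yI ne by (auto simp: I_iff)
    next
      fix y assume y: "y \<in> ?L"
      have rk: "rk y < 2 * k + 1" using rk_I[OF y] small(2)[OF b(1)] by simp
      have "b # ?t \<in> ?I" using S_I insert.prems by blast
      then have "emb y (T # ?t)" using y by (auto simp: I_iff intro: emb_trans)
      moreover have "y \<noteq> T # ?t" using rk by auto
      moreover have "y \<notin> (\<lambda>a. a # ?t) ` {1..s}" using rk small(2) by auto
      ultimately show "y \<in> {y \<in> ?P. emb (b # ?t) y \<or> emb y (b # ?t)}"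
        using y by (auto simp: I_iff)
    qed
    have L: "spherical (?m b) ?n (order_complex ?L emb)"
      by (rule spherical_I_step_link[OF Suc.hyps Suc.prems b]; rule Suc.IH) (use Suc.prems in auto)
    have "spherical ((\<Sum>a\<in>A. ?m a) + ?m b) (Suc ?n) (order_complex (insert (b # ?t) ?P) emb)"
    proof (rule spherical_insert[OF _ _ insert.IH[OF AS] small(1)[OF b(1)] _ link L,
          where a = i and b = "2 * k + 1"])
      show "finite ?P" using finQ insert.hyps by simp
      show "?P \<subseteq> W" using P_I I_W by blast
      show "b # ?t \<notin> ?P" using b(1) insert.hyps by auto
      show "i < rk x \<and> rk x < 2 * k + 1" if "x \<in> ?L" for x
        using rk_I[OF that] small(2)[OF b(1)] by simp
    qed simp
    moreover have "insert (b # ?t) ?P = ?Q \<union> (\<lambda>a. a # ?t) ` insert b A" by auto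
    ultimately show ?case using insert.hyps by (simp add: add.commute)
  qed
  have "?Q \<union> (\<lambda>a. a # ?t) ` ?S = ?I"
  proof (intro subset_antisym subsetI)
    show "x \<in> ?I" if "x \<in> ?Q \<union> (\<lambda>a. a # ?t) ` ?S" for x using that S_I by blast
    fix x assume x: "x \<in> ?I"
    show "x \<in> ?Q \<union> (\<lambda>a. a # ?t) ` ?S"
    proof (cases "x \<in> (\<lambda>a. a # ?t) ` {1..s}")
      case True
      then obtain a where a: "x = a # ?t" "a \<in> {1..s}" by blast
      have "i \<le> k" if "a \<noteq> 1"
      proof (cases i)
        case (Suc h)
        then have "\<not> Lambda_le s 1 a" using that a(2) by (auto simp: Lambda_le_def)
        moreover have "emb (1 # replicate h 1) (a # ?t)" using x a(1) Suc by (simp add: I_iff)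
        ultimately have "emb (1 # replicate h 1) ?t" by simp
        then show ?thesis using Suc by (auto dest: list_emb_length)
      qed simp
      then show ?thesis using a by blast
    qed (use x in blast)
  qed
  \<comment> \<open>Every admissible letter contributes \<open>sphere_count i k\<close> when
    \<open>i \<le> k\<close>, and the letter 1 contributes the extra term. For
    \<open>i = Suc k\<close> only the letter 1 is admissible.\<close>
  moreover have "(\<Sum>a\<in>?S. ?m a) = sphere_count i (Suc k)"
  proof (cases "i \<le> k")
    case True
    then have "?S = insert 1 {2..s}" using s by auto
    then have "(\<Sum>a\<in>?S. ?m a) = ?m 1 + (\<Sum>a\<in>{2..s}. ?m a)" by simp
    also have "(\<Sum>a\<in>{2..s}. ?m a) = (\<Sum>a\<in>{2..s}. sphere_count i k)"
      using True by (intro sum.cong) auto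
    also have "\<dots> = (s - 1) * sphere_count i k" by simp
    also have "?m 1 + \<dots> = s * sphere_count i k + (if 1 \<le> i then sphere_count (i - 1) k else 0)"
      using True s by (cases s) auto
    finally show ?thesis using sphere_count_Suc[OF Suc.hyps True] by simp
  next
    case False
    then have "?S = {1}" "i = Suc k" using s Suc.prems by auto
    then show ?thesis using sphere_count_diag[OF Suc.hyps] by simp
  qed
  ultimately show ?case using add[of ?S] n by simp
qed

end

section \<open>Chebyshev coefficients as sphere numbers\<close>

lemma abs_coeff_gen_chebyshev:
  assumes s: "1 \<le> s" and "1 \<le> j" "i \<le> j"
  shows "\<bar>coeff (gen_chebyshev s (i + j)) (j - i)\<bar> = of_nat (Lambda_words.sphere_count s i j)"
proof -
  interpret Lambda_words s by unfold_locales (rule s)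
  obtain k where j: "j = Suc k" using assms(2) by (cases j) auto
  let ?c = "\<lambda>l. (- 1) ^ l * of_nat s powi (int (i + j) - 2 * int l - 1) *
    (of_nat (int_choose (int (i + j) - int l) l) * of_nat s
      - of_nat (int_choose (int (i + j) - int l - 1) l)) :: rat"
  have "coeff (gen_chebyshev s (i + j)) (j - i) =
      (\<Sum>l\<le>(i + j) div 2. if i + j - 2 * l = j - i then ?c l else 0)"
    unfolding gen_chebyshev_def coeff_sum coeff_monom ..
  \<comment> \<open>Since \<open>2 l \<le> i + j\<close>, the subtraction is exact and the exponent
    \<open>j - i\<close> occurs only at \<open>l = i\<close>.\<close>
  also have "\<dots> = (\<Sum>l\<le>(i + j) div 2. if l = i then ?c l else 0)"
    using assms(3) by (intro sum.cong) auto
  also have "\<dots> = ?c i"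
  proof -
    have "i \<le> (i + j) div 2" using assms(3) by simp
    then show ?thesis by simp
  qed
  finally have c: "coeff (gen_chebyshev s (i + j)) (j - i) = ?c i" .
  have ch: "int_choose (int (i + j) - int i) i = j choose i"
    "int_choose (int (i + j) - int i - 1) i = k choose i"
  proof -
    have "int (i + j) - int i = int j" "int (i + j) - int i - 1 = int k" by (simp_all add: j)
    then show "int_choose (int (i + j) - int i) i = j choose i"
      "int_choose (int (i + j) - int i - 1) i = k choose i"
      by (simp_all only: int_choose_def nat_int) simp_all
  qed
  have pw: "(of_nat s :: rat) powi (int (i + j) - 2 * int i - 1) * of_nat s = of_nat s ^ (j - i)"
  proof -
    have "(of_nat s :: rat) powi (int (i + j) - 2 * int i - 1) * of_nat s =
        of_nat s powi (int (i + j) - 2 * int i - 1 + 1)"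
      using s by (subst power_int_add) auto
    also have "int (i + j) - 2 * int i - 1 + 1 = int (j - i)" using assms(3) by simp
    finally show ?thesis by simp
  qed
  \<comment> \<open>By Pascal's rule \<open>(j choose i) s - (k choose i)\<close> equals
    \<open>(k choose (i - 1)) s + (k choose i) (s - 1)\<close>, with first term 0 for
    \<open>i = 0\<close>. In the case \<open>i = j\<close> the power of \<open>s\<close> has
    exponent -1, but \<open>k choose i\<close> is 0 and the remaining factor \<open>s\<close>
    cancels it.\<close>
  have "of_nat s powi (int (i + j) - 2 * int i - 1) *
      (of_nat (j choose i) * of_nat s - of_nat (k choose i)) = (of_nat (sphere_count i j) :: rat)"
  proof (cases "i \<le> k")
    case True
    then have "int (i + j) - 2 * int i - 1 = int (k - i)" by (simp add: j)
    then have p: "(of_nat s :: rat) powi (int (i + j) - 2 * int i - 1) = of_nat s ^ (k - i)" by simp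
    have "j - i = Suc (k - i)" using True j by simp
    then have "sphere_count i j = s ^ (k - i) *
        ((if i = 0 then 0 else k choose (i - 1)) * s + (k choose i) * (s - 1))"
      by (simp add: sphere_count_def j algebra_simps)
    then have "(of_nat (sphere_count i j) :: rat) = of_nat s ^ (k - i) *
        (of_nat (if i = 0 then 0 else k choose (i - 1)) * of_nat s + of_nat (k choose i) * (of_nat s - 1))"
      using s by (simp add: of_nat_diff)
    moreover have "j choose i = (if i = 0 then 0 else k choose (i - 1)) + (k choose i)"
      by (cases i) (simp_all add: j)
    then have "(of_nat (j choose i) :: rat) =
        of_nat (if i = 0 then 0 else k choose (i - 1)) + of_nat (k choose i)"
      by (metis of_nat_add)
    ultimately show ?thesis unfolding p by (simp add: algebra_simps)
  next
    case False
    then have "i = j" using assms(3) j by simp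
    then show ?thesis using pw by (simp add: sphere_count_def j binomial_eq_0)
  qed
  then have eq: "?c i = (- 1) ^ i * of_nat (sphere_count i j)"
    unfolding ch by (simp add: mult.assoc)
  show ?thesis unfolding c eq by (simp add: abs_mult power_abs)
qed


section \<open>The homotopy type of the interval\<close>

lemma geometric_realization_empty_face: "topspace (geometric_realization {{}}) = {}"
  by (auto simp: geometric_realization_def)

theorem theorem4p8:
  fixes s i j :: nat
  assumes "1 \<le> s" and "i \<le> j"
  shows "\<exists>m::nat. of_nat m = \<bar>coeff (gen_chebyshev s (i + j)) (j - i)\<bar> \<and>
           homotopic_to_wedge_of_spheres
             (geometric_realization
               (order_complex
                 (open_interval (lists (Lambda s)) (subword_le (Lambda_le s))
                    (replicate i 1) (replicate j (s + 1)))
                 (subword_le (Lambda_le s))))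
             m (2 * int j - int i - 2)"
proof -
  interpret Lambda_words s by unfold_locales (rule assms(1))
  let ?K = "order_complex (I (replicate i 1) (replicate j T)) emb"
  have goal: "?thesis \<longleftrightarrow> (\<exists>m::nat. of_nat m = \<bar>coeff (gen_chebyshev s (i + j)) (j - i)\<bar> \<and>
      homotopic_to_wedge_of_spheres (geometric_realization ?K) m (2 * int j - int i - 2))"
    unfolding subword_le_eq_list_emb I_def ..
  \<comment> \<open>For \<open>i \<le> j\<close> this covers exactly \<open>i = j = 0\<close> and
    \<open>i = j = 1\<close>, where no rank lies between those of the ends and the wedge is one
    empty sphere of dimension -2 or -1.\<close>
  have empty: "homotopic_to_wedge_of_spheres (geometric_realization ?K) 1 (2 * int j - int i - 2)"
    if "2 * j - i \<le> 1"
  proof -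
    have "x \<notin> I (replicate i 1) (replicate j T)" for x
      using rk_I[of x "replicate i 1" "replicate j T"] that by auto
    then have "I (replicate i 1) (replicate j T) = {}" by blast
    then have "topspace (geometric_realization ?K) = {}"
      using geometric_realization_empty_face by simp
    moreover have "\<not> 0 \<le> 2 * int j - int i - 2" using that by linarith
    ultimately show ?thesis unfolding homotopic_to_wedge_of_spheres_def by simp
  qed
  show ?thesis
  proof (cases "j = 0")
    case True
    \<comment> \<open>Only the constant term is left: \<open>s\<close> to the power -1 times
      \<open>1 * s - 0\<close>, as the binomial coefficient with upper index -1 is read as
      0.\<close>
    then have "coeff (gen_chebyshev s (i + j)) (j - i) = 1"
      using assms by (simp add: gen_chebyshev_def int_choose_def power_int_minus)
    then show ?thesis unfolding goal using empty True by (intro exI[of _ 1]) simp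
  next
    case False
    then have j: "1 \<le> j" by simp
    have sph: "spherical (sphere_count i j) (2 * j - i - 1) ?K" by (rule spherical_I[OF j assms(2)])
    have "homotopic_to_wedge_of_spheres (geometric_realization ?K) (sphere_count i j) (2 * int j - int i - 2)"
    proof (cases "2 * j - i \<le> 1")
      case True
      then have "i = 1" "j = 1" using assms(2) j by auto
      then have "sphere_count i j = 1" by (simp add: sphere_count_def)
      then show ?thesis using empty[OF True] by simp
    next
      case False
      have "{} \<in> ?K" by (simp add: order_complex_def Complete_Partial_Order.chain_def)
      then have "?K \<noteq> {}" by (metis empty_iff)
      moreover have "0 < 2 * j - i - 1" using False by simp
      ultimately have "homotopic_to_wedge_of_spheres (geometric_realization ?K) (sphere_count i j)
          (int (2 * j - i - 1) - 1)"
        by (rule spherical_imp_homotopic_to_wedge_of_spheres[OF sph _ _ infinite_UNIV_listI])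
      moreover have "int (2 * j - i - 1) - 1 = 2 * int j - int i - 2" using False by simp
      ultimately show ?thesis by simp
    qed
    then show ?thesis
      unfolding goal using abs_coeff_gen_chebyshev[OF assms(1) j assms(2)] by (intro exI[of _ "sphere_count i j"]) simp
  qed
qed

end
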